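(* Let $n\geq 1$. The manifold $\mathrm{Sym}^+(n)$ has a structure of Lie group given by the matrix multiplication of the Cholesky factors: for $\Sigma,\Sigma'\in\mathrm{Sym}^+(n)$, with $L=\mathrm{Chol}(\Sigma)$ and $L'=\mathrm{Chol}(\Sigma')$, the group law is $$\Sigma\star\Sigma'=(LL')(LL')^\top=L\Sigma'L^\top.$$ For all $\alpha>0$ and $\beta>-\frac{\alpha}{n}$, the affine-invariant metric $$g_\Sigma(X,X)=\alpha\,\mathrm{tr}(\Sigma^{-1}X\Sigma^{-1}X)+\beta\,\mathrm{tr}(\Sigma^{-1}X)^2$$ ($\Sigma\in\mathrm{Sym}^+(n)$, $X\in\mathrm{Sym}(n)$) is a left-invariant metric for this Lie group structure. It is the pullback by $\mathrm{Chol}$ of the left-invariant metric on the Lie group $\mathrm{LT}^+(n)$ whose inner product at $I_n$ is given, for $Z\in T_{I_n}\mathrm{LT}^+(n)\simeq\mathrm{LT}(n)$, by $$\langle Z|Z\rangle_{\alpha,\beta}=g_{I_n}(Z+Z^\top,Z+Z^\top)=2\alpha\,\mathrm{tr}(ZZ^\top)+2\alpha\,\mathrm{tr}(\mathrm{Diag}(Z)^2)+4\beta\,\mathrm{tr}(Z)^2.$$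
   Context: $\mathrm{Sym}(n)$ is the vector space of real symmetric $n\times n$ matrices and $\mathrm{Sym}^+(n)$ the manifold of symmetric positive definite ones. $\mathrm{LT}(n)$ is the vector space of real lower triangular matrices, and $\mathrm{LT}^+(n)$ is the Lie group (for matrix multiplication) of lower triangular matrices with positive diagonal entries. $\mathrm{Chol}:\mathrm{Sym}^+(n)\to\mathrm{LT}^+(n)$ is the Cholesky diffeomorphism sending $\Sigma$ to the unique $L\in\mathrm{LT}^+(n)$ with $\Sigma=LL^\top$. $\mathrm{Diag}(Z)$ is the diagonal matrix with the same diagonal as $Z$. *)

theory Defs
  imports "HOL-Analysis.Analysis" "HOL-Algebra.Group"
begin

section \<open>Smooth maps on relatively open subsets of a linear subspace\<close>

text \<open>
  A set \<open>U\<close> that is open in a linear subspace \<open>V\<close> of a normed space is a manifold with one global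
  chart, and every tangent space is identified with \<open>V\<close>. The derivative within \<open>U\<close> at a point
  of \<open>U\<close> is unique only on \<open>V\<close> (off \<open>V\<close>, \<^const>\<open>frechet_derivative\<close> makes an arbitrary choice), so
  everything below applies it only to directions in \<open>V\<close>.
\<close>

primrec Ck_on :: "nat \<Rightarrow> 'a::real_normed_vector set \<Rightarrow> 'a set \<Rightarrow> ('a \<Rightarrow> 'b::real_normed_vector) \<Rightarrow> bool"
where
  "Ck_on 0 V U f \<longleftrightarrow> continuous_on U f"
| "Ck_on (Suc k) V U f \<longleftrightarrow>
     (\<forall>x\<in>U. f differentiable (at x within U)) \<and>
     (\<forall>v\<in>V. Ck_on k V U (\<lambda>x. frechet_derivative f (at x within U) v))"

definition smooth_map_on :: "'a::real_normed_vector set \<Rightarrow> 'a set \<Rightarrow> ('a \<Rightarrow> 'b::real_normed_vector) \<Rightarrow> bool"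
where
  "smooth_map_on V U f \<longleftrightarrow> (\<forall>k. Ck_on k V U f)"

definition open_in_subspace :: "'a::real_normed_vector set \<Rightarrow> 'a set \<Rightarrow> bool"
where
  "open_in_subspace V U \<longleftrightarrow> subspace V \<and> openin (top_of_set V) U"

definition diffeomorphism_on ::
  "'a::real_normed_vector set \<Rightarrow> 'a set \<Rightarrow> 'b::real_normed_vector set \<Rightarrow> 'b set \<Rightarrow> ('a \<Rightarrow> 'b) \<Rightarrow> bool"
where
  "diffeomorphism_on V U V' U' f \<longleftrightarrow>
     open_in_subspace V U \<and> open_in_subspace V' U' \<and> bij_betw f U U' \<and>
     smooth_map_on V U f \<and> smooth_map_on V' U' (inv_into U f)"


section \<open>Lie groups and left-invariant Riemannian metrics\<close>

definition lie_group_on :: "'a::real_normed_vector set \<Rightarrow> 'a monoid \<Rightarrow> bool"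
where
  "lie_group_on V G \<longleftrightarrow>
     open_in_subspace V (carrier G) \<and> group G \<and>
     smooth_map_on (V \<times> V) (carrier G \<times> carrier G) (\<lambda>(x, y). x \<otimes>\<^bsub>G\<^esub> y) \<and>
     smooth_map_on V (carrier G) (m_inv G)"

definition inner_product_on :: "'a::real_vector set \<Rightarrow> ('a \<Rightarrow> 'a \<Rightarrow> real) \<Rightarrow> bool"
where
  "inner_product_on V b \<longleftrightarrow>
     (\<forall>v\<in>V. \<forall>w\<in>V. b v w = b w v) \<and>
     (\<forall>u\<in>V. \<forall>v\<in>V. \<forall>w\<in>V. b (u + v) w = b u w + b v w) \<and>
     (\<forall>c. \<forall>v\<in>V. \<forall>w\<in>V. b (c *\<^sub>R v) w = c * b v w) \<and>
     (\<forall>v\<in>V. v \<noteq> 0 \<longrightarrow> b v v > 0)"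

text \<open>A field of bilinear forms is written \<open>g x v w\<close> with base point \<open>x\<close> and tangent vectors \<open>v, w\<close>.\<close>

definition riemannian_metric_on ::
  "'a::real_normed_vector set \<Rightarrow> 'a set \<Rightarrow> ('a \<Rightarrow> 'a \<Rightarrow> 'a \<Rightarrow> real) \<Rightarrow> bool"
where
  "riemannian_metric_on V U g \<longleftrightarrow>
     (\<forall>x\<in>U. inner_product_on V (g x)) \<and>
     (\<forall>v\<in>V. \<forall>w\<in>V. smooth_map_on V U (\<lambda>x. g x v w))"

definition pullback_metric ::
  "'a::real_normed_vector set \<Rightarrow> ('a \<Rightarrow> 'b::real_normed_vector) \<Rightarrow> ('b \<Rightarrow> 'b \<Rightarrow> 'b \<Rightarrow> real)
     \<Rightarrow> 'a \<Rightarrow> 'a \<Rightarrow> 'a \<Rightarrow> real"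
where
  "pullback_metric U f g x v w =
     g (f x) (frechet_derivative f (at x within U) v) (frechet_derivative f (at x within U) w)"

text \<open>The differential at \<open>x\<close> of the left translation by \<open>a\<close>.\<close>

definition left_translation_deriv :: "'a::real_normed_vector monoid \<Rightarrow> 'a \<Rightarrow> 'a \<Rightarrow> 'a \<Rightarrow> 'a"
where
  "left_translation_deriv G a x = frechet_derivative (\<lambda>y. a \<otimes>\<^bsub>G\<^esub> y) (at x within carrier G)"

definition left_invariant_metric ::
  "'a::real_normed_vector set \<Rightarrow> 'a monoid \<Rightarrow> ('a \<Rightarrow> 'a \<Rightarrow> 'a \<Rightarrow> real) \<Rightarrow> bool"
where
  "left_invariant_metric V G g \<longleftrightarrow>
     riemannian_metric_on V (carrier G) g \<and>
     (\<forall>a\<in>carrier G. \<forall>x\<in>carrier G. \<forall>v\<in>V. \<forall>w\<in>V.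
        g (a \<otimes>\<^bsub>G\<^esub> x) (left_translation_deriv G a x v) (left_translation_deriv G a x w) = g x v w)"

text \<open>The left-invariant metric with prescribed inner product \<open>b\<close> on the tangent space at the identity.\<close>

definition left_invariant_extension ::
  "'a::real_normed_vector monoid \<Rightarrow> ('a \<Rightarrow> 'a \<Rightarrow> real) \<Rightarrow> 'a \<Rightarrow> 'a \<Rightarrow> 'a \<Rightarrow> real"
where
  "left_invariant_extension G b x v w =
     b (left_translation_deriv G (m_inv G x) x v) (left_translation_deriv G (m_inv G x) x w)"


section \<open>Matrices and the Cholesky map\<close>

type_synonym 'n sqmat = "((real, 'n) vec, 'n) vec"

definition sym_mats :: "'n::finite sqmat set"
where
  "sym_mats = {A. transpose A = A}"

definition spd_mats :: "'n::finite sqmat set"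
where
  "spd_mats = {A \<in> sym_mats. \<forall>x. x \<noteq> 0 \<longrightarrow> x \<bullet> (A *v x) > 0}"

text \<open>Triangularity refers to the linear order on the index type.\<close>

definition lt_mats :: "'n::{finite,linorder} sqmat set"
where
  "lt_mats = {A. \<forall>i j. i < j \<longrightarrow> A $ i $ j = 0}"

definition lt_pos_mats :: "'n::{finite,linorder} sqmat set"
where
  "lt_pos_mats = {A \<in> lt_mats. \<forall>i. A $ i $ i > 0}"

definition Diag :: "'n::finite sqmat \<Rightarrow> 'n::finite sqmat"
where
  "Diag Z = (\<chi> i j. if i = j then Z $ i $ j else 0)"

definition Chol :: "'n::{finite,linorder} sqmat \<Rightarrow> 'n sqmat"
where
  "Chol S = (THE L. L \<in> lt_pos_mats \<and> S = L ** transpose L)"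

definition lt_group :: "'n::{finite,linorder} sqmat monoid"
where
  "lt_group = \<lparr>carrier = lt_pos_mats, mult = (**), one = mat 1\<rparr>"

definition cholesky_group :: "'n::{finite,linorder} sqmat monoid"
where
  "cholesky_group =
     \<lparr>carrier = spd_mats,
      mult = (\<lambda>S T. (Chol S ** Chol T) ** transpose (Chol S ** Chol T)),
      one = mat 1\<rparr>"

text \<open>The symmetric bilinear form obtained by polarization from
  \<open>g\<^sub>S(X,X) = \<alpha> tr(S\<inverse>XS\<inverse>X) + \<beta> tr(S\<inverse>X)\<^sup>2\<close>.\<close>

definition affine_invariant_metric ::
  "real \<Rightarrow> real \<Rightarrow> 'n::finite sqmat \<Rightarrow> 'n::finite sqmat \<Rightarrow> 'n::finite sqmat \<Rightarrow> real"
where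
  "affine_invariant_metric \<alpha> \<beta> S X Y =
     \<alpha> * trace (matrix_inv S ** X ** matrix_inv S ** Y)
     + \<beta> * trace (matrix_inv S ** X) * trace (matrix_inv S ** Y)"

definition lt_inner :: "real \<Rightarrow> real \<Rightarrow> 'n::finite sqmat \<Rightarrow> 'n::finite sqmat \<Rightarrow> real"
where
  "lt_inner \<alpha> \<beta> Z W =
     affine_invariant_metric \<alpha> \<beta> (mat 1) (Z + transpose Z) (W + transpose W)"

end

theory Submission
  imports Defs
begin

text \<open>
  The Cholesky map is shown to be continuous and then differentiable by hand, with
  \<open>d Chol\<^sub>\<Sigma>(X) = L \<cdot> low(L\<^sup>-\<^sup>1 X L\<^sup>-\<^sup>T)\<close> where \<open>L = Chol \<Sigma>\<close> and \<open>low\<close> keeps the strictly lower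
  part and half the diagonal. This derivative is a polynomial in \<open>L\<close> and \<open>L\<^sup>-\<^sup>1\<close>, so smoothness
  follows by bootstrapping: if \<open>Chol\<close> is \<open>C\<^sup>k\<close>, its derivative is \<open>C\<^sup>k\<close> as well. The affine-invariant
  metric is invariant under every congruence \<open>\<Sigma> \<mapsto> A \<Sigma> A\<^sup>T\<close>. Left translations of the Cholesky group
  are such congruences, and the choice \<open>A = L\<^sup>-\<^sup>1\<close> moves \<open>\<Sigma>\<close> to the identity matrix, which gives
  positivity and the pullback formula because \<open>low(M) + low(M)\<^sup>T = M\<close> for symmetric \<open>M\<close>.
\<close>

section \<open>Calculus of \<open>C\<^sup>k\<close> maps on relatively open sets\<close>

text \<open>The factor L is given only implicitly by S = L L^T. Comparing two factors through D =
  L^-1 L' - 1 leaves an equation that is quadratic in D, and it makes D small of first order only if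
  D is already known to be small. Continuity therefore has to come first and from an independent
  source: an explicit estimate near the identity matrix, to which congruence by L^-1 reduces every
  other point.

  The domains lie in subspaces V of the matrices that are in general proper, so a derivative is
  determined only along V. Regularity is hence always stated for one fixed direction v in V at a
  time. The calculus needs closure only under linear maps, bilinear products and matrix inversion,
  because the derivatives of inversion and of \<open>Chol\<close> are built by these operations from
  the maps themselves.

  The bound on \<beta> is spectral: at the identity the quadratic form \<alpha> tr(X^2) + \<beta>
  (tr X)^2 on symmetric matrices has eigenvalue \<alpha> on trace-free matrices and \<alpha> + n
  \<beta> on multiples of the identity.\<close>

lemma has_derivative_within_relopen_unique:
  assumes U: "open_in_subspace V U" and x: "x \<in> U" and v: "v \<in> V"
    and f: "(f has_derivative f') (at x within U)" "(f has_derivative f'') (at x within U)"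
  shows "f' v = f'' v"
proof -
  obtain W where W: "open W" "U = V \<inter> W" and V: "subspace V"
    using U by (auto simp: open_in_subspace_def openin_open)
  \<comment> \<open>The line through x in direction v stays in U for small t because v lies in V.
    Restricted to it, f is a function of one real variable on an open set, whose derivative at 0 is
    unique.\<close>
  define \<gamma> where "\<gamma> t = x + t *\<^sub>R v" for t
  define T where "T = \<gamma> -` W"
  have T: "open T" "0 \<in> T"
    unfolding T_def \<gamma>_def using W x by (auto intro!: open_vimage continuous_intros)
  have im: "\<gamma> ` T \<subseteq> U"
  proof
    fix y assume "y \<in> \<gamma> ` T"
    then obtain t where "y = x + t *\<^sub>R v" "y \<in> W"
      unfolding T_def \<gamma>_def by blast
    moreover have "x + t *\<^sub>R v \<in> V"
      using V v x W by (intro subspace_add subspace_scale) auto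
    ultimately show "y \<in> U" using W by simp
  qed
  have g: "(\<gamma> has_derivative (\<lambda>t. t *\<^sub>R v)) (at 0 within T)"
    unfolding \<gamma>_def by (auto intro!: derivative_eq_intros)
  have comp: "(f \<circ> \<gamma> has_derivative (\<lambda>t. h (t *\<^sub>R v))) (at 0)"
    if "(f has_derivative h) (at x within U)" for h
  proof -
    have "(f has_derivative h) (at (\<gamma> 0) within \<gamma> ` T)"
      using that im by (auto simp: \<gamma>_def intro: has_derivative_subset)
    from diff_chain_within[OF g this] show ?thesis
      unfolding at_within_open[OF T(2,1)] by (simp only: o_def)
  qed
  from has_derivative_unique[OF comp[OF f(1)] comp[OF f(2)]] show ?thesis
    by (metis scaleR_one)
qed

lemma has_derivative_frechet:
  "f differentiable (at x within U) \<Longrightarrow>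
    (f has_derivative frechet_derivative f (at x within U)) (at x within U)"
  using frechet_derivative_works by blast

lemma frechet_derivative_relopen:
  assumes "open_in_subspace V U" "x \<in> U" "v \<in> V" "(f has_derivative f') (at x within U)"
  shows "frechet_derivative f (at x within U) v = f' v"
  using assms has_derivative_within_relopen_unique has_derivative_frechet differentiableI by metis

lemma frechet_derivative_within_cong:
  assumes "x \<in> U" "\<And>y. y \<in> U \<Longrightarrow> f y = g y"
  shows "frechet_derivative f (at x within U) = frechet_derivative g (at x within U)"
proof -
  have "(f has_derivative h) (at x within U) \<longleftrightarrow> (g has_derivative h) (at x within U)" for h
    using assms has_derivative_transform by metis
  then show ?thesis
    by (simp add: frechet_derivative_def)
qed

text \<open>Needed because \<open>m_inv\<close>, \<open>inv_into\<close> and the left-invariant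
  extension agree with their matrix formulas on U only.\<close>

lemma Ck_on_cong:
  assumes "\<And>y. y \<in> U \<Longrightarrow> f y = g y"
  shows "Ck_on k V U f \<longleftrightarrow> Ck_on k V U g"
  using assms
proof (induction k arbitrary: f g)
  case 0
  then show ?case by (simp cong: continuous_on_cong)
next
  case (Suc k)
  have *: "f differentiable (at x within U) \<longleftrightarrow> g differentiable (at x within U)" if "x \<in> U" for x
    using Suc.prems that has_derivative_transform unfolding differentiable_def by metis
  have "Ck_on k V U (\<lambda>x. frechet_derivative f (at x within U) v)
      = Ck_on k V U (\<lambda>x. frechet_derivative g (at x within U) v)" for v
    using Suc.prems by (intro Suc.IH) (simp add: frechet_derivative_within_cong[where f=f and g=g])
  with * show ?case by auto
qed

text \<open>Any derivative field f' may stand in for the arbitrary choice made by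
  \<open>frechet_derivative\<close>, since the two agree on the directions in V.\<close>

lemma Ck_on_SucI:
  assumes "open_in_subspace V U"
    and "\<And>x. x \<in> U \<Longrightarrow> (f has_derivative f' x) (at x within U)"
    and "\<And>v. v \<in> V \<Longrightarrow> Ck_on k V U (\<lambda>x. f' x v)"
  shows "Ck_on (Suc k) V U f"
proof -
  have "Ck_on k V U (\<lambda>x. frechet_derivative f (at x within U) v)" if "v \<in> V" for v
    using assms(3)[OF that] Ck_on_cong[of U "\<lambda>x. frechet_derivative f (at x within U) v" "\<lambda>x. f' x v"]
      frechet_derivative_relopen[OF assms(1) _ that assms(2)] by auto
  then show ?thesis
    using assms(2) by (auto simp: differentiable_def)
qed

lemma Ck_on_SucE:
  assumes "Ck_on (Suc k) V U f"
  obtains f' where "\<And>x. x \<in> U \<Longrightarrow> (f has_derivative f' x) (at x within U)"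
    and "\<And>v. v \<in> V \<Longrightarrow> Ck_on k V U (\<lambda>x. f' x v)"
proof (rule that[of "\<lambda>x. frechet_derivative f (at x within U)"])
  show "(f has_derivative frechet_derivative f (at x within U)) (at x within U)" if "x \<in> U" for x
    using assms that by (intro has_derivative_frechet) auto
  show "Ck_on k V U (\<lambda>x. frechet_derivative f (at x within U) v)" if "v \<in> V" for v
    using assms that by auto
qed

lemma Ck_on_SucD: "Ck_on (Suc k) V U f \<Longrightarrow> Ck_on k V U f"
proof (induction k arbitrary: f)
  case 0
  then show ?case
    by (auto simp: continuous_on_eq_continuous_within intro: differentiable_imp_continuous_within)
next
  case (Suc k)
  then show ?case by (metis Ck_on.simps(2))
qed

section \<open>Closure of C^k maps under linear and bilinear operations\<close>

lemma Ck_on_const: "open_in_subspace V U \<Longrightarrow> Ck_on k V U (\<lambda>x. c)"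
proof (induction k arbitrary: c)
  case (Suc k)
  then show ?case by (intro Ck_on_SucI[where f' = "\<lambda>_ _. 0"]) auto
qed simp

lemma Ck_on_linear:
  assumes "open_in_subspace V U" "bounded_linear T"
  shows "Ck_on k V U T"
proof (cases k)
  case 0
  then show ?thesis using assms linear_continuous_on by auto
next
  case (Suc m)
  then show ?thesis
    using assms
    by (auto simp del: Ck_on.simps intro!: Ck_on_SucI[where f' = "\<lambda>_. T"] Ck_on_const
        bounded_linear_imp_has_derivative)
qed

lemma Ck_on_compose_linear:
  assumes "open_in_subspace V U" "bounded_linear T" "Ck_on k V U f"
  shows "Ck_on k V U (\<lambda>x. T (f x))"
  using assms(3)
proof (induction k arbitrary: f)
  case 0
  then show ?case
    using assms(2) by (auto intro: bounded_linear.continuous_on)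
next
  case (Suc k)
  then obtain f' where "\<And>x. x \<in> U \<Longrightarrow> (f has_derivative f' x) (at x within U)"
    "\<And>v. v \<in> V \<Longrightarrow> Ck_on k V U (\<lambda>x. f' x v)"
    using Ck_on_SucE by blast
  with Suc.IH assms show ?case
    by (intro Ck_on_SucI[where f' = "\<lambda>x v. T (f' x v)"]) (auto intro: bounded_linear.has_derivative)
qed

lemma Ck_on_add:
  assumes "open_in_subspace V U" "Ck_on k V U f" "Ck_on k V U g"
  shows "Ck_on k V U (\<lambda>x. f x + g x)"
  using assms(2,3)
proof (induction k arbitrary: f g)
  case 0
  then show ?case by (auto intro: continuous_on_add)
next
  case (Suc k)
  obtain f' g' where "\<And>x. x \<in> U \<Longrightarrow> (f has_derivative f' x) (at x within U)"
    "\<And>v. v \<in> V \<Longrightarrow> Ck_on k V U (\<lambda>x. f' x v)"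
    "\<And>x. x \<in> U \<Longrightarrow> (g has_derivative g' x) (at x within U)"
    "\<And>v. v \<in> V \<Longrightarrow> Ck_on k V U (\<lambda>x. g' x v)"
    using Suc.prems Ck_on_SucE by metis
  with Suc.IH assms(1) show ?case
    by (intro Ck_on_SucI[where f' = "\<lambda>x v. f' x v + g' x v"]) (auto intro: has_derivative_add)
qed

lemma Ck_on_bilinear:
  assumes "open_in_subspace V U" "bounded_bilinear b" "Ck_on k V U f" "Ck_on k V U g"
  shows "Ck_on k V U (\<lambda>x. b (f x) (g x))"
  using assms(3,4)
proof (induction k arbitrary: f g)
  case 0
  then show ?case
    using assms(2) by (auto intro: bounded_bilinear.continuous_on)
next
  case (Suc k)
  obtain f' g' where *: "\<And>x. x \<in> U \<Longrightarrow> (f has_derivative f' x) (at x within U)"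
    "\<And>v. v \<in> V \<Longrightarrow> Ck_on k V U (\<lambda>x. f' x v)"
    "\<And>x. x \<in> U \<Longrightarrow> (g has_derivative g' x) (at x within U)"
    "\<And>v. v \<in> V \<Longrightarrow> Ck_on k V U (\<lambda>x. g' x v)"
    using Suc.prems Ck_on_SucE by metis
  show ?case
  proof (rule Ck_on_SucI[OF assms(1)])
    show "((\<lambda>x. b (f x) (g x)) has_derivative (\<lambda>v. b (f x) (g' x v) + b (f' x v) (g x))) (at x within U)"
      if "x \<in> U" for x
      using bounded_bilinear.FDERIV[OF assms(2)] * that by blast
    \<comment> \<open>Each summand pairs a derivative, which is C^k, with an undifferentiated
      factor, which \<open>Ck_on_SucD\<close> lowers from C^(k+1) to C^k so that the induction
      hypothesis covers the product.\<close>
    show "Ck_on k V U (\<lambda>x. b (f x) (g' x v) + b (f' x v) (g x))" if "v \<in> V" for v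
      using * that Suc.IH Suc.prems[THEN Ck_on_SucD] by (intro Ck_on_add[OF assms(1)]) auto
  qed
qed

text \<open>Serves to regard \<open>Chol\<close> of either component as a smooth function of a pair.
  The induction closes because the direction \<open>T v\<close> does not depend on the
  point.\<close>

lemma Ck_on_precompose_linear:
  assumes "open_in_subspace V U" "bounded_linear T" "T ` V \<subseteq> V'" "T ` U \<subseteq> U'"
    and "Ck_on k V' U' f"
  shows "Ck_on k V U (\<lambda>x. f (T x))"
  using assms(5)
proof (induction k arbitrary: f)
  case 0
  then show ?case
    using assms(4) continuous_on_compose2[OF _ linear_continuous_on[OF assms(2)]] by auto
next
  case (Suc k)
  then obtain f' where *: "\<And>x. x \<in> U' \<Longrightarrow> (f has_derivative f' x) (at x within U')"
    "\<And>v. v \<in> V' \<Longrightarrow> Ck_on k V' U' (\<lambda>x. f' x v)"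
    using Ck_on_SucE by blast
  show ?case
  proof (rule Ck_on_SucI[OF assms(1)])
    show "((\<lambda>x. f (T x)) has_derivative (\<lambda>v. f' (T x) (T v))) (at x within U)" if "x \<in> U" for x
    proof (rule has_derivative_in_compose[where f = T and g = f])
      show "(T has_derivative T) (at x within U)"
        using assms(2) by (rule bounded_linear_imp_has_derivative)
      show "(f has_derivative f' (T x)) (at (T x) within T ` U)"
        using * assms(4) that has_derivative_subset by blast
    qed
    show "Ck_on k V U (\<lambda>x. f' (T x) (T v))" if "v \<in> V" for v
      using Suc.IH[OF *(2)] that assms(3) by blast
  qed
qed

section \<open>Matrix algebra and inversion\<close>

lemma bounded_bilinear_matrix_matrix_mult:
  "bounded_bilinear ((**) :: real^'m^'n \<Rightarrow> real^'k^'m \<Rightarrow> real^'k^'n)"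
  unfolding bilinear_conv_bounded_bilinear[symmetric] bilinear_def linear_iff
  by (simp add: matrix_matrix_mult_def vec_eq_iff distrib_left distrib_right sum.distrib sum_distrib_left mult_ac)

lemmas matrix_mult_minus_right = bounded_bilinear.minus_right[OF bounded_bilinear_matrix_matrix_mult]
  and matrix_mult_diff_left = bounded_bilinear.diff_left[OF bounded_bilinear_matrix_matrix_mult]
  and matrix_mult_diff_right = bounded_bilinear.diff_right[OF bounded_bilinear_matrix_matrix_mult]

lemma bounded_linear_transpose: "bounded_linear (transpose :: real^'m^'n \<Rightarrow> real^'n^'m)"
  unfolding linear_conv_bounded_linear[symmetric] linear_iff
  by (simp add: transpose_def vec_eq_iff)

lemma bounded_linear_trace: "bounded_linear (trace :: real^'n^'n \<Rightarrow> real)"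
  unfolding linear_conv_bounded_linear[symmetric] linear_iff
  by (simp add: trace_def sum.distrib sum_distrib_left)

lemma transpose_add: "transpose (A + B) = transpose A + transpose B"
  by (simp add: transpose_def vec_eq_iff)

lemma trace_transpose: "trace (transpose A) = trace A"
  by (simp add: trace_def transpose_def)

lemma inner_matrix_vector_transpose:
  fixes A :: "real^'n^'m"
  shows "x \<bullet> (A *v y) = (transpose A *v x) \<bullet> y"
  by (simp add: dot_lmul_matrix)

lemma matrix_inv_works:
  assumes "invertible A"
  shows "A ** matrix_inv A = mat 1" "matrix_inv A ** A = mat 1"
  using assms someI_ex[of "\<lambda>B. A ** B = mat 1 \<and> B ** A = mat 1"]
  unfolding invertible_def matrix_inv_def by blast+

lemma matrix_inv_unique:
  fixes A :: "real^'n^'n"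
  assumes "A ** B = mat 1"
  shows "matrix_inv A = B"
  using assms
  by (metis invertible_right_inverse matrix_inv_works(2) matrix_mul_assoc matrix_mul_lid matrix_mul_rid)

lemma invertible_matrix_inv: "invertible A \<Longrightarrow> invertible (matrix_inv A)"
  using matrix_inv_works unfolding invertible_def by blast

lemma matrix_inv_mult:
  fixes A B :: "real^'n^'n"
  assumes "invertible A" "invertible B"
  shows "matrix_inv (A ** B) = matrix_inv B ** matrix_inv A"
  using assms by (intro matrix_inv_unique) (metis matrix_inv_works(1) matrix_mul_assoc matrix_mul_rid)

lemma matrix_inv_transpose:
  fixes A :: "real^'n^'n"
  assumes "invertible A"
  shows "matrix_inv (transpose A) = transpose (matrix_inv A)"
  using assms by (intro matrix_inv_unique) (metis matrix_inv_works(2) matrix_transpose_mul transpose_mat)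

lemma matrix_inv_cancel:
  fixes A :: "real^'n^'n"
  assumes "invertible A"
  shows "A ** (matrix_inv A ** B) = B" "matrix_inv A ** (A ** B) = B"
    "B ** A ** matrix_inv A = B" "B ** matrix_inv A ** A = B"
  using assms by (metis matrix_inv_works matrix_mul_assoc matrix_mul_lid matrix_mul_rid)+

lemma trace_similar:
  fixes A B :: "real^'n^'n"
  assumes "invertible A"
  shows "trace (matrix_inv A ** B ** A) = trace B"
  using assms by (metis trace_mul_sym matrix_inv_cancel(1) matrix_mul_assoc)

text \<open>Both matrix inversion and the Cholesky map are differentiated through a remainder of
  second order.\<close>

lemma has_derivative_within_quadratic:
  assumes "bounded_linear f'"
    and "\<forall>\<^sub>F y in at x within U. norm (f y - f x - f' (y - x)) \<le> C * (norm (y - x))\<^sup>2"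
  shows "(f has_derivative f') (at x within U)"
  unfolding has_derivative_within
proof
  show "((\<lambda>y. (1 / norm (y - x)) *\<^sub>R (f y - (f x + f' (y - x)))) \<longlongrightarrow> 0) (at x within U)"
  proof (rule Lim_null_comparison)
    show "\<forall>\<^sub>F y in at x within U.
        norm ((1 / norm (y - x)) *\<^sub>R (f y - (f x + f' (y - x)))) \<le> C * norm (y - x)"
      using assms(2)
    proof eventually_elim
      case (elim y)
      have "norm ((1 / norm (y - x)) *\<^sub>R (f y - (f x + f' (y - x))))
          = norm (f y - f x - f' (y - x)) / norm (y - x)"
        by (simp only: norm_scaleR diff_diff_eq) simp
      also have "\<dots> \<le> C * norm (y - x)"
        using elim by (cases "y = x") (simp_all add: divide_le_eq power2_eq_square mult_ac)
      finally show ?case .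
    qed
    show "((\<lambda>y. C * norm (y - x)) \<longlongrightarrow> 0) (at x within U)"
      by (auto intro!: tendsto_eq_intros)
  qed
qed (fact assms(1))

text \<open>The resolvent identity. Used once it bounds the inverses near A; used twice it exposes
  the second-order remainder.\<close>

lemma matrix_inv_diff:
  fixes A B :: "real^'n^'n"
  assumes "invertible A" "invertible B"
  shows "matrix_inv B - matrix_inv A = - (matrix_inv A ** (B - A) ** matrix_inv B)"
  unfolding matrix_mult_diff_right matrix_mult_diff_left
  by (simp add: assms matrix_inv_works matrix_inv_cancel)

lemma has_derivative_matrix_inv:
  fixes A :: "real^'n^'n"
  assumes "A \<in> U" and inv: "\<And>B. B \<in> U \<Longrightarrow> invertible B"
  shows "(matrix_inv has_derivative (\<lambda>H. - (matrix_inv A ** H ** matrix_inv A))) (at A within U)"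
proof -
  obtain K where K: "K > 0" "\<And>(X :: real^'n^'n) (Y :: real^'n^'n). norm (X ** Y) \<le> norm X * norm Y * K"
    using bounded_bilinear.pos_bounded[OF bounded_bilinear_matrix_matrix_mult] by blast
  have K3: "norm (X ** Y ** Z) \<le> K\<^sup>2 * norm X * norm Y * norm Z" for X Y Z :: "real^'n^'n"
  proof -
    have "norm (X ** Y ** Z) \<le> norm (X ** Y) * norm Z * K"
      by (rule K(2))
    also have "\<dots> \<le> (norm X * norm Y * K) * norm Z * K"
      using K by (intro mult_right_mono) auto
    finally show ?thesis by (simp add: power2_eq_square mult_ac)
  qed
  define a where "a = norm (matrix_inv A)"
  \<comment> \<open>Chosen so that \<open>K\<^sup>2 * a * ?r\<close> is at most 1/2; the summand 1
    keeps the denominator positive without any lower bound on a.\<close>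
  let ?r = "1 / (2 * K\<^sup>2 * a + 1)"
  have a: "a \<ge> 0" by (simp add: a_def)
  then have r: "?r > 0" by (simp add: add_nonneg_pos)
  have invA: "invertible A" using assms by blast
  \<comment> \<open>The resolvent identity bounds the norm of B^-1 by a plus half of itself, and
    that half is absorbed on the left.\<close>
  have bound: "norm (matrix_inv B) \<le> 2 * a" if "B \<in> U" "norm (B - A) < ?r" for B
  proof -
    have "norm (matrix_inv B) \<le> a + norm (matrix_inv B - matrix_inv A)"
      unfolding a_def by (metis add.commute diff_add_cancel norm_triangle_ineq)
    also have "\<dots> \<le> a + K\<^sup>2 * a * norm (B - A) * norm (matrix_inv B)"
      using K3[of "matrix_inv A" "B - A" "matrix_inv B"] invA inv[OF that(1)]
      by (simp add: matrix_inv_diff a_def)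
    also have "\<dots> \<le> a + (1/2) * norm (matrix_inv B)"
    proof -
      have "K\<^sup>2 * a * norm (B - A) \<le> K\<^sup>2 * a * ?r"
        using that a by (intro mult_left_mono) auto
      also have "\<dots> \<le> 1/2"
        using r by (simp add: field_simps)
      finally show ?thesis by (intro add_left_mono mult_right_mono) auto
    qed
    finally show ?thesis by simp
  qed
  have "\<forall>\<^sub>F B in at A within U. norm (B - A) < ?r \<and> B \<in> U"
    using r by (auto simp: eventually_at dist_norm intro!: exI[of _ ?r])
  then have "\<forall>\<^sub>F B in at A within U. norm (matrix_inv B - matrix_inv A
      - - (matrix_inv A ** (B - A) ** matrix_inv A)) \<le> (K^4 * a * a * (2 * a)) * (norm (B - A))\<^sup>2"
  proof eventually_elim
    case (elim B)
    then have B: "invertible B" "norm (matrix_inv B) \<le> 2 * a"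
      using inv bound by auto
    note e = matrix_inv_diff[OF invA B(1)]
    \<comment> \<open>After the first-order term is removed, one difference of inverses is left
      beside a factor B - A. Expanding that difference again supplies the second factor B -
      A.\<close>
    have "matrix_inv B - matrix_inv A - - (matrix_inv A ** (B - A) ** matrix_inv A)
        = matrix_inv A ** (B - A) ** (- (matrix_inv B - matrix_inv A))"
      unfolding matrix_mult_minus_right
      by (simp add: matrix_mult_diff_right[of "matrix_inv A ** (B - A)"]) (rule e)
    also have "\<dots> = matrix_inv A ** (B - A) ** (matrix_inv A ** (B - A) ** matrix_inv B)"
      unfolding e minus_minus by (rule refl)
    also have "norm \<dots> \<le> K\<^sup>2 * a * norm (B - A) * norm (matrix_inv A ** (B - A) ** matrix_inv B)"
      unfolding a_def by (rule K3)
    also have "\<dots> \<le> K\<^sup>2 * a * norm (B - A) * (K\<^sup>2 * a * norm (B - A) * norm (matrix_inv B))"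
      unfolding a_def by (intro mult_left_mono K3) auto
    also have "\<dots> \<le> K\<^sup>2 * a * norm (B - A) * (K\<^sup>2 * a * norm (B - A) * (2 * a))"
      using B(2) a by (intro mult_left_mono) auto
    finally show ?case by (simp add: power2_eq_square power4_eq_xxxx mult_ac)
  qed
  then show ?thesis
  proof (rule has_derivative_within_quadratic[rotated])
    show "bounded_linear (\<lambda>H. - (matrix_inv A ** H ** matrix_inv A))"
      by (intro bounded_linear_minus
          bounded_linear_compose[OF bounded_bilinear.bounded_linear_left[OF bounded_bilinear_matrix_matrix_mult]
            bounded_bilinear.bounded_linear_right[OF bounded_bilinear_matrix_matrix_mult]])
  qed
qed

section \<open>C^k regularity of matrix expressions\<close>

lemma Ck_on_matrix_mult:
  fixes f :: "'a::real_normed_vector \<Rightarrow> real^'m^'n" and g :: "'a \<Rightarrow> real^'k^'m"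
  assumes "open_in_subspace V U" "Ck_on k V U f" "Ck_on k V U g"
  shows "Ck_on k V U (\<lambda>x. f x ** g x)"
  by (rule Ck_on_bilinear[OF assms(1) bounded_bilinear_matrix_matrix_mult assms(2,3)])

lemma Ck_on_transpose:
  fixes f :: "'a::real_normed_vector \<Rightarrow> real^'m^'n"
  assumes "open_in_subspace V U" "Ck_on k V U f"
  shows "Ck_on k V U (\<lambda>x. transpose (f x))"
  by (rule Ck_on_compose_linear[OF assms(1) bounded_linear_transpose assms(2)])

text \<open>The derivative contains no new function besides f' and the inverse itself, so the
  inverse being C^k makes its derivative C^k.\<close>

lemma Ck_on_matrix_inv:
  fixes f :: "'a::real_normed_vector \<Rightarrow> real^'n^'n"
  assumes U: "open_in_subspace V U" and inv: "\<And>x. x \<in> U \<Longrightarrow> invertible (f x)"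
    and f: "Ck_on k V U f"
  shows "Ck_on k V U (\<lambda>x. matrix_inv (f x))"
  using f
proof (induction k)
  case 0
  have "continuous_on (f ` U) matrix_inv"
    using has_derivative_matrix_inv[of _ "f ` U"] inv has_derivative_continuous
    by (fastforce simp: continuous_on_eq_continuous_within)
  then show ?case
    using 0 continuous_on_compose2[of "f ` U" matrix_inv U f] by simp
next
  case (Suc k)
  then obtain f' where *: "\<And>x. x \<in> U \<Longrightarrow> (f has_derivative f' x) (at x within U)"
    "\<And>v. v \<in> V \<Longrightarrow> Ck_on k V U (\<lambda>x. f' x v)"
    using Ck_on_SucE by blast
  have IH: "Ck_on k V U (\<lambda>x. matrix_inv (f x))"
    using Suc Ck_on_SucD by blast
  show ?case
  proof (rule Ck_on_SucI[OF U])
    show "((\<lambda>x. matrix_inv (f x)) has_derivative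
        (\<lambda>v. - (matrix_inv (f x) ** f' x v ** matrix_inv (f x)))) (at x within U)" if "x \<in> U" for x
      using *(1)[OF that] that inv
      by (intro has_derivative_in_compose[OF _ has_derivative_matrix_inv]) auto
    show "Ck_on k V U (\<lambda>x. - (matrix_inv (f x) ** f' x v ** matrix_inv (f x)))" if "v \<in> V" for v
      using IH *(2)[OF that]
      by (intro Ck_on_compose_linear[OF U bounded_linear_minus[OF bounded_linear_ident]]
          Ck_on_matrix_mult U)
  qed
qed

section \<open>Triangular matrices\<close>

lemma lt_mats_nth: "A \<in> lt_mats \<Longrightarrow> i < j \<Longrightarrow> A $ i $ j = 0"
  by (simp add: lt_mats_def)

lemma lt_pos_matsD: "A \<in> lt_pos_mats \<Longrightarrow> A \<in> lt_mats" "A \<in> lt_pos_mats \<Longrightarrow> A $ i $ i > 0"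
  by (auto simp: lt_pos_mats_def)

text \<open>P is a down-closed set of indices. With P always true this gives injectivity of R; with
  P the indices before j it gives triangularity of the inverse.\<close>

lemma lt_forward_substitution:
  fixes R :: "'n::{finite,linorder} sqmat"
  assumes R: "R \<in> lt_mats" "\<And>i. R $ i $ i \<noteq> 0"
    and P: "\<And>k l. P k \<Longrightarrow> l < k \<Longrightarrow> P l" and zero: "\<And>k. P k \<Longrightarrow> (R *v x) $ k = 0"
    and k: "P k"
  shows "x $ k = 0"
proof (rule ccontr)
  define M where "M = {k. P k \<and> x $ k \<noteq> 0}"
  define m where "m = Min M"
  assume "x $ k \<noteq> 0"
  with k have "M \<noteq> {}" by (auto simp: M_def)
  then have m: "m \<in> M" "\<And>l. l \<in> M \<Longrightarrow> m \<le> l"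
    unfolding m_def by auto
  \<comment> \<open>At the first index m of P where x does not vanish, row m reduces to its diagonal
    term: earlier entries of x vanish by minimality, later entries of R by triangularity.\<close>
  have *: "R $ m $ l * x $ l = (if l = m then R $ m $ m * x $ m else 0)" for l
  proof (cases l m rule: linorder_cases)
    case less
    then show ?thesis using m P unfolding M_def by (metis (mono_tags, lifting) leD mem_Collect_eq mult_eq_0_iff)
  qed (use R in \<open>auto simp: lt_mats_nth\<close>)
  have "(R *v x) $ m = (\<Sum>l\<in>UNIV. if l = m then R $ m $ m * x $ m else 0)"
    unfolding matrix_vector_mult_def vec_lambda_beta by (rule sum.cong[OF refl *])
  with zero m R show False by (auto simp: M_def)
qed

lemma lt_pos_invertible:
  fixes R :: "'n::{finite,linorder} sqmat"
  assumes "R \<in> lt_pos_mats"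
  shows "invertible R"
  unfolding invertible_left_inverse matrix_left_invertible_ker
proof (intro allI impI)
  fix x assume "R *v x = 0"
  then have "x $ k = 0" for k
    using assms lt_forward_substitution[of R "\<lambda>_. True" x k]
    by (simp add: lt_pos_matsD less_imp_neq[THEN not_sym])
  then show "x = 0" by (simp add: vec_eq_iff)
qed

lemma lt_mats_mult:
  fixes A B :: "'n::{finite,linorder} sqmat"
  assumes "A \<in> lt_mats" "B \<in> lt_mats"
  shows "A ** B \<in> lt_mats"
proof -
  have "A $ i $ k * B $ k $ j = 0" if "i < j" for i j k
    using that assms lt_mats_nth[of A i k] lt_mats_nth[of B k j] by (cases "i < k") auto
  then show ?thesis
    by (auto simp: lt_mats_def matrix_matrix_mult_def intro!: sum.neutral)
qed

lemma lt_mats_mult_diag: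
  fixes A B :: "'n::{finite,linorder} sqmat"
  assumes "A \<in> lt_mats" "B \<in> lt_mats"
  shows "(A ** B) $ i $ i = A $ i $ i * B $ i $ i"
proof -
  have *: "A $ i $ k * B $ k $ i = (if k = i then A $ i $ i * B $ i $ i else 0)" for k
    using assms lt_mats_nth[of A i k] lt_mats_nth[of B k i] by (cases k i rule: linorder_cases) auto
  have "(A ** B) $ i $ i = (\<Sum>k\<in>UNIV. if k = i then A $ i $ i * B $ i $ i else 0)"
    unfolding matrix_matrix_mult_def vec_lambda_beta by (rule sum.cong[OF refl *])
  then show ?thesis by simp
qed

lemma mat_1_lt_pos: "mat 1 \<in> lt_pos_mats"
  by (simp add: lt_pos_mats_def lt_mats_def mat_def)

lemma lt_pos_mats_mult:
  fixes A B :: "'n::{finite,linorder} sqmat"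
  assumes "A \<in> lt_pos_mats" "B \<in> lt_pos_mats"
  shows "A ** B \<in> lt_pos_mats"
  using assms by (simp add: lt_pos_mats_def lt_mats_mult lt_mats_mult_diag)

text \<open>Column j of the inverse solves R x = e_j, whose right side is zero before j, so forward
  substitution makes x zero there. The diagonal entries are reciprocals of those of R.\<close>

lemma lt_pos_mats_inv:
  fixes R :: "'n::{finite,linorder} sqmat"
  assumes R: "R \<in> lt_pos_mats"
  shows "matrix_inv R \<in> lt_pos_mats"
proof -
  note RR = matrix_inv_works[OF lt_pos_invertible[OF R]]
  have lt: "matrix_inv R \<in> lt_mats"
    unfolding lt_mats_def
  proof (intro CollectI allI impI)
    fix k j :: 'n
    assume "k < j"
    have "(R *v column j (matrix_inv R)) $ l = 0" if "l < j" for l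
    proof -
      have "(R *v column j (matrix_inv R)) $ l = (R ** matrix_inv R) $ l $ j"
        by (simp add: matrix_vector_mult_def matrix_matrix_mult_def column_def)
      then show ?thesis using that by (simp add: RR mat_def)
    qed
    then have "column j (matrix_inv R) $ k = 0"
      using R \<open>k < j\<close> lt_forward_substitution[of R "\<lambda>k. k < j" "column j (matrix_inv R)" k]
      by (simp add: lt_pos_matsD less_imp_neq[THEN not_sym])
    then show "matrix_inv R $ k $ j = 0" by (simp add: column_def)
  qed
  have "matrix_inv R $ i $ i > 0" for i
  proof -
    have "R $ i $ i * matrix_inv R $ i $ i = 1"
      using lt_mats_mult_diag[OF lt_pos_matsD(1)[OF R] lt, of i] by (simp add: RR mat_def)
    then show ?thesis using lt_pos_matsD(2)[OF R, of i]
      by (metis zero_less_mult_pos zero_less_one)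
  qed
  with lt show ?thesis by (simp add: lt_pos_mats_def)
qed

section \<open>Existence and uniqueness of the Cholesky factor\<close>

lemma spd_matsD:
  "S \<in> spd_mats \<Longrightarrow> transpose S = S" "S \<in> spd_mats \<Longrightarrow> S \<in> sym_mats"
  "S \<in> spd_mats \<Longrightarrow> x \<noteq> 0 \<Longrightarrow> x \<bullet> (S *v x) > 0"
  by (auto simp: spd_mats_def sym_mats_def)

lemma sym_mats_congruence: "S \<in> sym_mats \<Longrightarrow> A ** S ** transpose A \<in> sym_mats"
  by (simp add: sym_mats_def matrix_transpose_mul matrix_mul_assoc)

lemma spd_mats_congruence:
  fixes A S :: "'n::finite sqmat"
  assumes S: "S \<in> spd_mats" and A: "invertible A"
  shows "A ** S ** transpose A \<in> spd_mats"
  unfolding spd_mats_def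
proof (intro CollectI conjI allI impI)
  show "A ** S ** transpose A \<in> sym_mats"
    using S by (simp add: spd_matsD sym_mats_congruence)
  fix x :: "real^'n" assume "x \<noteq> 0"
  then have "transpose A *v x \<noteq> 0"
    using inj_matrix_vector_mult[OF transpose_invertible[OF A]] by (metis injD matrix_vector_mult_0_right)
  then have "(transpose A *v x) \<bullet> (S *v (transpose A *v x)) > 0"
    by (rule spd_matsD(3)[OF S])
  also have "(transpose A *v x) \<bullet> (S *v (transpose A *v x)) = x \<bullet> ((A ** S ** transpose A) *v x)"
    by (simp only: inner_matrix_vector_transpose[symmetric] matrix_vector_mul_assoc matrix_mul_assoc)
  finally show "x \<bullet> ((A ** S ** transpose A) *v x) > 0" .
qed

lemma mat_1_spd: "mat 1 \<in> spd_mats"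
  by (simp add: spd_mats_def sym_mats_def)

lemma lt_pos_spd:
  assumes "L \<in> lt_pos_mats"
  shows "L ** transpose L \<in> spd_mats"
  using spd_mats_congruence[OF mat_1_spd lt_pos_invertible[OF assms]] by simp

text \<open>A Gram-Schmidt vector for the form S: e_i plus a combination of earlier basis vectors,
  S-orthogonal to all of those. Up to scaling it is row i of the inverse Cholesky factor. One linear
  system per row replaces an induction on the matrix size, which is fixed by the index type.\<close>

lemma spd_conjugate_vector:
  fixes S :: "'n::{finite,linorder} sqmat"
  assumes S: "S \<in> spd_mats"
  shows "\<exists>r. r $ i = 1 \<and> (\<forall>k>i. r $ k = 0) \<and> (\<forall>k<i. (S *v r) $ k = 0)"
proof -
  \<comment> \<open>The leading block of S on the indices before i, padded with an identity block to
    remain a square matrix over the same index type.\<close>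
  define A :: "'n sqmat" where
    "A = (\<chi> k l. if k < i then (if l < i then S $ k $ l else 0) else if k = l then 1 else 0)"
  have A1: "(A *v x) $ k = x $ k" if "\<not> k < i" for x k
  proof -
    have "(A *v x) $ k = (\<Sum>l\<in>UNIV. if l = k then x $ l else 0)"
      using that unfolding matrix_vector_mult_def A_def vec_lambda_beta
      by (intro sum.cong) auto
    then show ?thesis by simp
  qed
  have A2: "(A *v x) $ k = (S *v x) $ k" if "k < i" "\<And>l. \<not> l < i \<Longrightarrow> x $ l = 0" for x k
    using that unfolding matrix_vector_mult_def A_def vec_lambda_beta by (intro sum.cong) auto
  \<comment> \<open>A kernel vector x vanishes from i on, and S x vanishes before i. So
    \<open>x \<bullet> (S *v x) = 0\<close>, and positive definiteness gives x = 0.\<close>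
  have "invertible A"
    unfolding invertible_left_inverse matrix_left_invertible_ker
  proof (intro allI impI)
    fix x assume *: "A *v x = 0"
    have hi: "x $ l = 0" if "\<not> l < i" for l
      using A1[OF that, of x] * by simp
    have "x \<bullet> (S *v x) = (\<Sum>k\<in>UNIV. x $ k * (S *v x) $ k)"
      by (simp add: inner_vec_def)
    also have "\<dots> = 0"
    proof (intro sum.neutral ballI)
      fix k
      show "x $ k * (S *v x) $ k = 0"
        using hi[of k] A2[of k x] hi * by (cases "k < i") auto
    qed
    finally show "x = 0" using spd_matsD(3)[OF S, of x] by force
  qed
  then obtain B where B: "A ** B = mat 1"
    unfolding invertible_def by blast
  \<comment> \<open>Minus column i of S before i, so that adding \<open>axis i 1\<close> to the
    solution makes S times the sum vanish there.\<close>
  define b where "b = (\<chi> k::'n. if k < i then - S $ k $ i else 0)"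
  define x where "x = B *v b"
  have Ax: "A *v x = b" by (simp add: x_def matrix_vector_mul_assoc B)
  have hi: "x $ l = 0" if "\<not> l < i" for l
    using A1[OF that, of x] that by (simp add: Ax b_def)
  have "(S *v (x + axis i 1)) $ k = 0" if "k < i" for k
  proof -
    have "(S *v x) $ k = - S $ k $ i"
      using A2[of k x] that hi by (simp add: Ax b_def)
    then show ?thesis
      by (simp add: matrix_vector_right_distrib matrix_vector_mult_basis column_def)
  qed
  then show ?thesis
    using hi by (intro exI[of _ "x + axis i 1"]) (auto simp: axis_def)
qed

lemma inner_vanish:
  fixes x y :: "real^'n"
  assumes "\<And>k. x $ k = 0 \<or> y $ k = 0"
  shows "x \<bullet> y = 0"
  using assms by (auto simp: inner_vec_def intro!: sum.neutral)

text \<open>The conjugate vectors r_i are S-orthogonal, so the matrix T of their S-normalized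
  versions satisfies T S T^T = 1, and L = T^-1 is the factor.\<close>

lemma cholesky_exists:
  fixes S :: "'n::{finite,linorder} sqmat"
  assumes S: "S \<in> spd_mats"
  shows "\<exists>L \<in> lt_pos_mats. S = L ** transpose L"
proof -
  obtain r where r: "\<And>i. r i $ i = 1" "\<And>i k. i < k \<Longrightarrow> r i $ k = 0"
    "\<And>i k. k < i \<Longrightarrow> (S *v r i) $ k = 0"
    using spd_conjugate_vector[OF S] by metis
  define d where "d i = r i \<bullet> (S *v r i)" for i
  have d: "d i > 0" for i
    unfolding d_def using spd_matsD(3)[OF S] r(1)[of i] by (metis zero_index zero_neq_one)
  \<comment> \<open>r_i is supported on indices up to i, while S r_j vanishes before j; for i < j
    the two supports are disjoint.\<close>
  have lower: "r i \<bullet> (S *v r j) = 0" if "i < j" for i j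
    using r that by (intro inner_vanish) (metis not_less_iff_gr_or_eq order.strict_trans)
  have orth: "r i \<bullet> (S *v r j) = 0" if "i \<noteq> j" for i j
  proof (cases "i < j")
    case False
    then have "r j \<bullet> (S *v r i) = 0" using that by (intro lower) auto
    then show ?thesis
      by (metis inner_matrix_vector_transpose inner_commute spd_matsD(1)[OF S])
  qed (rule lower)
  define T :: "'n sqmat" where "T = (\<chi> i. (1 / sqrt (d i)) *\<^sub>R r i)"
  have T: "T \<in> lt_pos_mats"
    using d r by (auto simp: T_def lt_pos_mats_def lt_mats_def)
  have "(T ** S ** transpose T) $ i $ j = mat 1 $ i $ j" for i j
  proof -
    have "(T ** S ** transpose T) $ i $ j = T $ i \<bullet> (S *v T $ j)"
      unfolding matrix_mul_assoc[symmetric]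
      by (simp add: matrix_matrix_mult_def matrix_vector_mult_def inner_vec_def transpose_def)
    also have "\<dots> = (1 / sqrt (d i)) * (1 / sqrt (d j)) * (r i \<bullet> (S *v r j))"
      by (simp add: T_def matrix_vector_mult_scaleR)
    also have "\<dots> = mat 1 $ i $ j"
      using orth[of i j] d[of i] by (auto simp: mat_def d_def[symmetric])
    finally show ?thesis .
  qed
  then have TST: "T ** S ** transpose T = mat 1" by (simp add: vec_eq_iff)
  note iT = lt_pos_invertible[OF T]
  have "S = matrix_inv T ** (T ** S ** transpose T) ** matrix_inv (transpose T)"
    using iT transpose_invertible[OF iT] by (simp add: matrix_inv_cancel flip: matrix_mul_assoc)
       (simp add: matrix_inv_cancel matrix_mul_assoc)
  also have "\<dots> = matrix_inv T ** transpose (matrix_inv T)"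
    using iT by (simp add: TST matrix_inv_transpose)
  finally show ?thesis using lt_pos_mats_inv[OF T] by blast
qed

text \<open>K^-1 L is orthogonal and lower triangular, so its inverse, which is its transpose, is
  lower triangular too. It is therefore diagonal with positive entries of square 1.\<close>

lemma cholesky_unique:
  fixes L K :: "'n::{finite,linorder} sqmat"
  assumes L: "L \<in> lt_pos_mats" and K: "K \<in> lt_pos_mats"
    and eq: "L ** transpose L = K ** transpose K"
  shows "L = K"
proof -
  note iL = lt_pos_invertible[OF L] and iK = lt_pos_invertible[OF K]
  define T where "T = matrix_inv K ** L"
  have T: "T \<in> lt_pos_mats"
    unfolding T_def using L K by (intro lt_pos_mats_mult lt_pos_mats_inv)
  have "T ** transpose T = matrix_inv K ** (L ** transpose L) ** transpose (matrix_inv K)"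
    by (simp add: T_def matrix_transpose_mul matrix_mul_assoc)
  also have "\<dots> = transpose K ** matrix_inv (transpose K)"
    unfolding eq matrix_inv_transpose[OF iK, symmetric]
    by (simp add: matrix_mul_assoc matrix_inv_works iK)
  also have "\<dots> = mat 1"
    by (rule matrix_inv_works[OF transpose_invertible[OF iK]])
  finally have TT: "T ** transpose T = mat 1" .
  then have inv: "matrix_inv T = transpose T" by (rule matrix_inv_unique)
  have lower: "transpose T \<in> lt_mats"
    using lt_pos_mats_inv[OF T] inv by (simp add: lt_pos_matsD)
  have "T $ i $ j = mat 1 $ i $ j" for i j
  proof (cases i j rule: linorder_cases)
    case less
    then show ?thesis using T by (simp add: lt_pos_matsD lt_mats_nth mat_def)
  next
    case equal
    have "T $ i $ i * T $ i $ i = 1"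
      using lt_mats_mult_diag[OF lt_pos_matsD(1)[OF T] lower, of i] TT by (simp add: transpose_def mat_def)
    then have "T $ i $ i = 1"
      using lt_pos_matsD(2)[OF T, of i] by (simp add: square_eq_1_iff)
    with equal show ?thesis by (simp add: mat_def)
  next
    case greater
    then show ?thesis using lt_mats_nth[OF lower greater] by (simp add: transpose_def mat_def)
  qed
  then have "T = mat 1" by (simp add: vec_eq_iff)
  then show ?thesis using matrix_inv_cancel(1)[OF iK, of L] by (simp add: T_def)
qed

lemma Chol_mult_transpose:
  assumes "L \<in> lt_pos_mats"
  shows "Chol (L ** transpose L) = L"
  unfolding Chol_def using assms cholesky_unique by (intro the_equality) auto

lemma Chol_works:
  assumes "S \<in> spd_mats"
  shows "Chol S \<in> lt_pos_mats" "Chol S ** transpose (Chol S) = S"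
  using cholesky_exists[OF assms] by (auto simp: Chol_mult_transpose)

section \<open>Smoothness of the Cholesky map\<close>

lemma subspace_sym_mats: "subspace sym_mats"
  by (auto simp: subspace_def sym_mats_def transpose_def vec_eq_iff)

lemma subspace_lt_mats: "subspace lt_mats"
  by (auto simp: subspace_def lt_mats_def)

lemma lt_pos_open: "open_in_subspace lt_mats (lt_pos_mats :: 'n::{finite,linorder} sqmat set)"
proof -
  have *: "open (\<Inter>i::'n. {A :: 'n sqmat. 0 < A $ i $ i})"
    by (intro open_INT ballI open_Collect_less continuous_intros) auto
  have "lt_pos_mats = lt_mats \<inter> (\<Inter>i::'n. {A :: 'n sqmat. 0 < A $ i $ i})"
    by (auto simp: lt_pos_mats_def)
  then show ?thesis
    using openin_open_Int[OF *, of lt_mats] by (simp only: open_in_subspace_def subspace_lt_mats)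
qed

text \<open>x . S x is the squared norm of L^T x, and an injective linear map in finite dimension is
  bounded below.\<close>

lemma spd_coercive:
  fixes S :: "'n::{finite,linorder} sqmat"
  assumes S: "S \<in> spd_mats"
  obtains c where "c > 0" "\<And>x. c * (norm x)\<^sup>2 \<le> x \<bullet> (S *v x)"
proof -
  let ?L = "transpose (Chol S)"
  have "inj ((*v) ?L)"
    by (intro inj_matrix_vector_mult transpose_invertible lt_pos_invertible Chol_works S)
  then obtain B where B: "B > 0" "\<And>x. B * norm x \<le> norm (?L *v x)"
    using linear_inj_bounded_below_pos[of "(*v) ?L"] by auto
  show ?thesis
  proof (rule that)
    show "B\<^sup>2 > 0" using B by simp
    fix x
    have "(B * norm x)\<^sup>2 \<le> (norm (?L *v x))\<^sup>2"
      using B by (intro power_mono) auto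
    also have "\<dots> = x \<bullet> ((Chol S ** ?L) *v x)"
      by (simp only: power2_norm_eq_inner inner_matrix_vector_transpose[symmetric] matrix_vector_mul_assoc[symmetric])
    finally show "B\<^sup>2 * (norm x)\<^sup>2 \<le> x \<bullet> (S *v x)"
      using Chol_works(2)[OF S] by (simp add: power_mult_distrib)
  qed
qed

lemma bounded_bilinear_matrix_vector_mult:
  "bounded_bilinear ((*v) :: real^'m^'n \<Rightarrow> real^'m \<Rightarrow> real^'n)"
  unfolding bilinear_conv_bounded_bilinear[symmetric] bilinear_def linear_iff
  by (simp add: matrix_vector_mult_add_rdistrib matrix_vector_right_distrib
      matrix_vector_mult_scaleR scaleR_matrix_vector_assoc)

lemma spd_open: "open_in_subspace sym_mats (spd_mats :: 'n::{finite,linorder} sqmat set)"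
  unfolding open_in_subspace_def openin_contains_ball
proof (intro conjI ballI subspace_sym_mats)
  show "spd_mats \<subseteq> sym_mats" by (auto simp: spd_mats_def)
  fix S :: "'n sqmat" assume "S \<in> spd_mats"
  then obtain c where c: "c > 0" "\<And>x. c * (norm x)\<^sup>2 \<le> x \<bullet> (S *v x)"
    using spd_coercive by blast
  obtain K where K: "K > 0" "\<And>(A :: 'n sqmat) x. norm (A *v x) \<le> norm A * norm x * K"
    using bounded_bilinear.pos_bounded[OF bounded_bilinear_matrix_vector_mult] by blast
  \<comment> \<open>Within distance c / K the quadratic form changes by less than c |x|^2, which
    coercivity can afford.\<close>
  have "A \<in> spd_mats" if "A \<in> sym_mats" "dist S A < c / K" for A
    unfolding spd_mats_def
  proof (intro CollectI conjI allI impI that(1))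
    fix x :: "(real, 'n) vec" assume x: "x \<noteq> 0"
    have "norm (S - A) * K < c"
      using that(2) K(1) by (simp add: dist_norm pos_less_divide_eq)
    have "x \<bullet> ((S - A) *v x) \<le> norm x * norm ((S - A) *v x)"
      by (rule norm_cauchy_schwarz)
    also have "\<dots> \<le> norm x * (norm (S - A) * norm x * K)"
      using K(2) by (intro mult_left_mono) auto
    also have "\<dots> = (norm (S - A) * K) * (norm x)\<^sup>2"
      by (simp add: power2_eq_square)
    also have "\<dots> < c * (norm x)\<^sup>2"
      using x \<open>norm (S - A) * K < c\<close> by (intro mult_strict_right_mono) auto
    also have "\<dots> \<le> x \<bullet> (S *v x)" by (rule c)
    finally show "x \<bullet> (A *v x) > 0"
      by (simp add: matrix_vector_mult_diff_rdistrib inner_diff_right)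
  qed
  then show "\<exists>e>0. ball S e \<inter> sym_mats \<subseteq> spd_mats"
    using c K by (intro exI[of _ "c / K"]) auto
qed

lemma spd_invertible:
  fixes S :: "'n::{finite,linorder} sqmat"
  assumes "S \<in> spd_mats"
  shows "invertible S"
  by (metis Chol_works[OF assms] invertible_mult lt_pos_invertible transpose_invertible)

text \<open>The inverse of Z \<mapsto> Z + Z^T, a linear bijection from lower triangular onto
  symmetric matrices; the diagonal is halved because symmetrizing doubles it.\<close>

definition lower_half :: "'n::{finite,linorder} sqmat \<Rightarrow> 'n sqmat" where
  "lower_half M = (\<chi> i j. if j < i then M $ i $ j else if j = i then M $ i $ j / 2 else 0)"

lemma bounded_linear_lower_half: "bounded_linear lower_half"
  unfolding linear_conv_bounded_linear[symmetric] linear_iff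
  by (simp add: lower_half_def vec_eq_iff add_divide_distrib)

lemma lower_half_lt: "lower_half M \<in> lt_mats"
  by (auto simp: lower_half_def lt_mats_def)

lemma lower_half_add_transpose:
  assumes "Z \<in> lt_mats"
  shows "lower_half (Z + transpose Z) = Z"
  unfolding vec_eq_iff
proof (intro allI)
  fix i j
  show "lower_half (Z + transpose Z) $ i $ j = Z $ i $ j"
    using assms by (cases i j rule: linorder_cases) (auto simp: lower_half_def transpose_def lt_mats_nth)
qed

lemma lower_half_sym:
  assumes "M \<in> sym_mats"
  shows "lower_half M + transpose (lower_half M) = M"
  unfolding vec_eq_iff
proof (intro allI)
  fix i j
  have "M $ i $ j = M $ j $ i"
    using assms by (auto simp: sym_mats_def transpose_def vec_eq_iff)
  then show "(lower_half M + transpose (lower_half M)) $ i $ j = M $ i $ j"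
    by (cases i j rule: linorder_cases) (auto simp: lower_half_def transpose_def)
qed

text \<open>Continuity of \<^const>\<open>Chol\<close> comes from this bound: for \<open>M = K K\<^sup>T\<close>, the diagonal of \<open>M\<close>
  gives the squared row norms of \<open>K\<close>, and the diagonal of \<open>M\<^sup>-\<^sup>1\<close> bounds the diagonal of \<open>K\<close>
  from below.\<close>

lemma lt_pos_dist_mat_1:
  fixes K :: "'n::{finite,linorder} sqmat"
  assumes K: "K \<in> lt_pos_mats"
  defines "M \<equiv> K ** transpose K"
  shows "(norm (K - mat 1))\<^sup>2 \<le> (\<Sum>i\<in>UNIV. M $ i $ i + 1 - 2 / sqrt (matrix_inv M $ i $ i))"
proof -
  note iK = lt_pos_invertible[OF K]
  have diag: "1 / sqrt (matrix_inv M $ i $ i) \<le> K $ i $ i" for i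
  proof -
    have pos: "K $ i $ i > 0" by (rule lt_pos_matsD[OF K])
    have "K $ i $ i * matrix_inv K $ i $ i = 1"
      using lt_mats_mult_diag[OF lt_pos_matsD(1)[OF K] lt_pos_matsD(1)[OF lt_pos_mats_inv[OF K]], of i]
      by (simp add: matrix_inv_works[OF iK] mat_def)
    then have "1 / K $ i $ i = matrix_inv K $ i $ i"
      using pos by (simp add: field_simps)
    then have "(1 / K $ i $ i)\<^sup>2 = (matrix_inv K $ i $ i)\<^sup>2"
      by simp
    \<comment> \<open>The sum is the squared norm of column i of K^-1, that is, the diagonal entry i
      of K^-T K^-1 = M^-1.\<close>
    also have "\<dots> \<le> (\<Sum>j\<in>UNIV. (matrix_inv K $ j $ i)\<^sup>2)"
      by (rule member_le_sum) auto
    also have "\<dots> = matrix_inv M $ i $ i"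
      unfolding M_def matrix_inv_mult[OF iK transpose_invertible[OF iK]] matrix_inv_transpose[OF iK]
      by (simp add: matrix_matrix_mult_def transpose_def power2_eq_square)
    finally have "1 / K $ i $ i \<le> sqrt (matrix_inv M $ i $ i)"
      by (rule real_le_rsqrt)
    moreover have "0 < 1 / K $ i $ i" using pos by simp
    ultimately have "inverse (sqrt (matrix_inv M $ i $ i)) \<le> inverse (1 / K $ i $ i)"
      by (intro le_imp_inverse_le)
    then show ?thesis by (simp add: inverse_eq_divide)
  qed
  \<comment> \<open>The square expands to tr M - 2 tr K + n, so only a lower bound on the diagonal
    of K is needed. Each summand of the final bound is 0 at M = 1, which is what
    \<open>Chol_tendsto\<close> exploits.\<close>
  have "(norm (K - mat 1))\<^sup>2 = K \<bullet> K - 2 * (K \<bullet> mat 1) + (mat 1 :: 'n sqmat) \<bullet> mat 1"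
    by (simp add: power2_norm_eq_inner inner_diff_left inner_diff_right inner_commute[of "mat 1" K])
  also have "K \<bullet> K = (\<Sum>i\<in>UNIV. M $ i $ i)"
    by (simp add: M_def inner_vec_def matrix_matrix_mult_def transpose_def)
  also have "K \<bullet> mat 1 = (\<Sum>i\<in>UNIV. K $ i $ i)"
    by (simp add: inner_vec_def mat_def if_distrib cong: if_cong)
  also have "(mat 1 :: 'n sqmat) \<bullet> mat 1 = (\<Sum>i\<in>(UNIV :: 'n set). 1)"
    by (simp add: inner_vec_def mat_def if_distrib cong: if_cong)
  also have "(\<Sum>i\<in>UNIV. M $ i $ i) - 2 * (\<Sum>i\<in>UNIV. K $ i $ i) + (\<Sum>i\<in>(UNIV :: 'n set). 1)
      = (\<Sum>i\<in>UNIV. M $ i $ i + 1 - 2 * K $ i $ i)"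
    by (simp only: sum.distrib sum_subtractf sum_distrib_left)
  also have "\<dots> \<le> (\<Sum>i\<in>UNIV. M $ i $ i + 1 - 2 / sqrt (matrix_inv M $ i $ i))"
  proof (rule sum_mono)
    show "M $ i $ i + 1 - 2 * K $ i $ i \<le> M $ i $ i + 1 - 2 / sqrt (matrix_inv M $ i $ i)" for i
      using diag[of i] by simp
  qed
  finally show ?thesis .
qed

lemma matrix_inv_mat_1: "matrix_inv (mat 1 :: real^'n^'n) = mat 1"
  by (rule matrix_inv_unique) simp

lemma Chol_whitening:
  fixes S :: "'n::{finite,linorder} sqmat"
  assumes S: "S \<in> spd_mats"
  shows "matrix_inv (Chol S) ** S ** transpose (matrix_inv (Chol S)) = mat 1"
proof -
  let ?L = "Chol S"
  note iL = lt_pos_invertible[OF Chol_works(1)[OF S]]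
  have "matrix_inv ?L ** (?L ** transpose ?L) ** transpose (matrix_inv ?L) = mat 1"
    unfolding matrix_inv_transpose[OF iL, symmetric]
    by (simp add: matrix_inv_cancel iL matrix_inv_works transpose_invertible)
  then show ?thesis by (simp add: Chol_works(2)[OF S])
qed

text \<open>With A = L^-1, the matrix \<open>A ** Chol T\<close> is the Cholesky factor of A T A^T,
  which tends to the identity as T tends to S. Only continuity at the identity is then needed, and
  \<open>lt_pos_dist_mat_1\<close> supplies it.\<close>

lemma Chol_tendsto:
  fixes S :: "'n::{finite,linorder} sqmat"
  assumes S: "S \<in> spd_mats"
  shows "((\<lambda>T. matrix_inv (Chol S) ** Chol T - mat 1) \<longlongrightarrow> 0) (at S within spd_mats)"
proof -
  define A where "A = matrix_inv (Chol S)"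
  define M where "M T = A ** T ** transpose A" for T
  have A: "A \<in> lt_pos_mats" unfolding A_def by (intro lt_pos_mats_inv Chol_works S)
  have MS: "M S = mat 1" unfolding M_def A_def by (rule Chol_whitening[OF S])
  have Mspd: "M T \<in> spd_mats" if "T \<in> spd_mats" for T
    unfolding M_def using that A by (intro spd_mats_congruence lt_pos_invertible)
  have CM: "Ck_on 0 sym_mats spd_mats M"
    unfolding M_def by (intro Ck_on_matrix_mult Ck_on_const Ck_on_linear spd_open bounded_linear_ident)
  have "continuous_on spd_mats M" "continuous_on spd_mats (\<lambda>T. matrix_inv (M T))"
    using CM Ck_on_matrix_inv[OF spd_open spd_invertible[OF Mspd] CM] by simp_all
  then have "(M \<longlongrightarrow> mat 1) (at S within spd_mats)"
    "((\<lambda>T. matrix_inv (M T)) \<longlongrightarrow> mat 1) (at S within spd_mats)"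
    using S by (auto simp: continuous_on_def MS matrix_inv_mat_1 dest!: bspec[where x = S])
  then have "((\<lambda>T. \<Sum>i\<in>UNIV. M T $ i $ i + 1 - 2 / sqrt (matrix_inv (M T) $ i $ i))
      \<longlongrightarrow> (\<Sum>i\<in>(UNIV :: 'n set). (mat 1 :: 'n sqmat) $ i $ i + 1 - 2 / sqrt ((mat 1 :: 'n sqmat) $ i $ i)))
      (at S within spd_mats)"
    by (intro tendsto_intros) (auto simp: mat_def)
  then have lim: "((\<lambda>T. \<Sum>i\<in>UNIV. M T $ i $ i + 1 - 2 / sqrt (matrix_inv (M T) $ i $ i)) \<longlongrightarrow> 0)
      (at S within spd_mats)"
    by (simp add: mat_def)
  have "(norm (A ** Chol T - mat 1))\<^sup>2 \<le> (\<Sum>i\<in>UNIV. M T $ i $ i + 1 - 2 / sqrt (matrix_inv (M T) $ i $ i))"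
    if T: "T \<in> spd_mats" for T
  proof -
    have "M T = (A ** Chol T) ** transpose (A ** Chol T)"
      unfolding M_def by (subst Chol_works(2)[OF T, symmetric]) (simp add: matrix_transpose_mul matrix_mul_assoc)
    then show ?thesis
      using lt_pos_dist_mat_1[OF lt_pos_mats_mult[OF A Chol_works(1)[OF T]]] by simp
  qed
  then have "\<forall>\<^sub>F T in at S within spd_mats. norm ((norm (A ** Chol T - mat 1))\<^sup>2)
      \<le> (\<Sum>i\<in>UNIV. M T $ i $ i + 1 - 2 / sqrt (matrix_inv (M T) $ i $ i))"
    by (auto simp: eventually_at_filter)
  from Lim_null_comparison[OF this lim]
  have "((\<lambda>T. (norm (A ** Chol T - mat 1))\<^sup>2) \<longlongrightarrow> 0) (at S within spd_mats)" .
  then have "((\<lambda>T. sqrt ((norm (A ** Chol T - mat 1))\<^sup>2)) \<longlongrightarrow> sqrt 0) (at S within spd_mats)"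
    by (rule tendsto_real_sqrt)
  then show ?thesis
    unfolding A_def by (simp add: tendsto_norm_zero_iff)
qed

text \<open>Differentiating S = L L^T gives X = dL L^T + L dL^T. With Z = L^-1 dL, which is lower
  triangular, this reads L^-1 X L^-T = Z + Z^T, solved by \<open>lower_half\<close>.\<close>

definition Chol_deriv :: "'n::{finite,linorder} sqmat \<Rightarrow> 'n sqmat \<Rightarrow> 'n sqmat" where
  "Chol_deriv S X = Chol S ** lower_half (matrix_inv (Chol S) ** X ** transpose (matrix_inv (Chol S)))"

lemma bounded_linear_congruence:
  fixes A :: "real^'n^'m"
  shows "bounded_linear (\<lambda>X. A ** X ** transpose A)"
  by (rule bounded_linear_compose[OF bounded_bilinear.bounded_linear_left[OF bounded_bilinear_matrix_matrix_mult]
        bounded_bilinear.bounded_linear_right[OF bounded_bilinear_matrix_matrix_mult]])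

lemma bounded_linear_matrix_mult_right:
  fixes A :: "real^'n^'m"
  shows "bounded_linear (\<lambda>X :: real^'k^'n. A ** X)"
  by (rule bounded_bilinear.bounded_linear_right[OF bounded_bilinear_matrix_matrix_mult])

text \<open>With \<open>D = L\<^sup>-\<^sup>1 L' - 1\<close> and \<open>H = L\<^sup>-\<^sup>1 (S' - S) L\<^sup>-\<^sup>T\<close> one has \<open>H = D + D\<^sup>T + D D\<^sup>T\<close>, so
  \<open>D = lower_half H - lower_half (D D\<^sup>T)\<close>. Once \<open>D\<close> is known to tend to \<open>0\<close>, the quadratic term
  is absorbed and \<open>D = lower_half H\<close> up to \<open>O(H\<^sup>2)\<close>.\<close>

lemma has_derivative_Chol:
  fixes S :: "'n::{finite,linorder} sqmat"
  assumes S: "S \<in> spd_mats"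
  shows "(Chol has_derivative Chol_deriv S) (at S within spd_mats)"
proof -
  define L where "L = Chol S"
  define A where "A = matrix_inv L"
  define h where "h X = lower_half (A ** X ** transpose A)" for X
  define D where "D T = A ** Chol T - mat 1" for T
  have L: "L \<in> lt_pos_mats" unfolding L_def by (rule Chol_works[OF S])
  note iL = lt_pos_invertible[OF L]
  have A: "A \<in> lt_pos_mats" unfolding A_def by (rule lt_pos_mats_inv[OF L])
  have h: "bounded_linear h"
    unfolding h_def by (rule bounded_linear_compose[OF bounded_linear_lower_half bounded_linear_congruence])
  obtain c0 where c0: "c0 > 0" "\<And>X. norm (h X) \<le> norm X * c0"
    using bounded_linear.pos_bounded[OF h] by blast
  obtain c2 where c2: "c2 > 0" "\<And>X :: 'n sqmat. norm (L ** X) \<le> norm X * c2"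
    using bounded_linear.pos_bounded[OF bounded_linear_matrix_mult_right] by blast
  obtain a where a: "a > 0" "\<And>(X :: 'n sqmat) (Y :: 'n sqmat). norm (X ** Y) \<le> norm X * norm Y * a"
    using bounded_bilinear.pos_bounded[OF bounded_bilinear_matrix_matrix_mult] by blast
  obtain b where b: "b > 0" "\<And>X :: 'n sqmat. norm (lower_half X) \<le> norm X * b"
    using bounded_linear.pos_bounded[OF bounded_linear_lower_half] by blast
  obtain t where t: "t > 0" "\<And>X :: 'n sqmat. norm (transpose X) \<le> norm X * t"
    using bounded_linear.pos_bounded[OF bounded_linear_transpose] by blast
  define c1 where "c1 = t * a * b"
  have c1: "c1 > 0" using a b t by (simp add: c1_def)
  have q: "norm (lower_half (X ** transpose X)) \<le> c1 * (norm X)\<^sup>2" for X :: "'n sqmat"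
  proof -
    have "norm (lower_half (X ** transpose X)) \<le> norm (X ** transpose X) * b" by (rule b)
    also have "\<dots> \<le> (norm X * norm (transpose X) * a) * b"
      using b by (intro mult_right_mono a) auto
    also have "\<dots> \<le> (norm X * (norm X * t) * a) * b"
      using a b by (intro mult_right_mono mult_left_mono t) auto
    finally show ?thesis by (simp add: c1_def power2_eq_square mult_ac)
  qed
  have D_eq: "D T = h (T - S) - lower_half (D T ** transpose (D T))" if T: "T \<in> spd_mats" for T
  proof -
    have D: "D T \<in> lt_mats"
      unfolding D_def using A T
      by (intro subspace_diff[OF subspace_lt_mats] lt_mats_mult lt_pos_matsD(1) mat_1_lt_pos Chol_works)
    have AC: "A ** Chol T = D T + mat 1" by (simp add: D_def)
    have "A ** (T - S) ** transpose A = A ** T ** transpose A - mat 1"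
      using Chol_whitening[OF S] by (simp add: matrix_mult_diff_left matrix_mult_diff_right A_def L_def)
    also have "A ** T ** transpose A = (A ** Chol T) ** transpose (A ** Chol T)"
      by (subst Chol_works(2)[OF T, symmetric]) (simp add: matrix_transpose_mul matrix_mul_assoc)
    also have "\<dots> - mat 1 = (D T + transpose (D T)) + D T ** transpose (D T)"
      unfolding AC
      by (simp add: transpose_add bounded_bilinear.add_left[OF bounded_bilinear_matrix_matrix_mult]
          matrix_add_ldistrib)
    finally have "h (T - S) = lower_half ((D T + transpose (D T)) + D T ** transpose (D T))"
      by (simp add: h_def)
    also have "\<dots> = D T + lower_half (D T ** transpose (D T))"
      using linear_add[OF bounded_linear.linear[OF bounded_linear_lower_half],
          of "D T + transpose (D T)" "D T ** transpose (D T)"]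
      by (simp only: lower_half_add_transpose[OF D])
    finally show ?thesis by simp
  qed
  have "(D \<longlongrightarrow> 0) (at S within spd_mats)"
    unfolding D_def A_def L_def by (rule Chol_tendsto[OF S])
  \<comment> \<open>Below the threshold \<open>1 / (2 * c1)\<close> the quadratic term is at most
    half of |D|, so |D| is at most twice the norm of h (T - S).\<close>
  then have "\<forall>\<^sub>F T in at S within spd_mats. norm (D T) < 1 / (2 * c1)"
    using c1 by (auto dest!: tendstoD[where e = "1 / (2 * c1)"])
  moreover have "\<forall>\<^sub>F T in at S within spd_mats. T \<in> spd_mats"
    by (simp add: eventually_at_filter)
  ultimately have ev: "\<forall>\<^sub>F T in at S within spd_mats.
      norm (Chol T - Chol S - L ** h (T - S)) \<le> (c1 * (2 * c0)\<^sup>2 * c2) * (norm (T - S))\<^sup>2"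
  proof eventually_elim
    case (elim T)
    have "c1 * (norm (D T))\<^sup>2 = (c1 * norm (D T)) * norm (D T)"
      by (simp add: power2_eq_square)
    also have "\<dots> \<le> (1/2) * norm (D T)"
      using elim c1 by (intro mult_right_mono) (auto simp: field_simps)
    finally have "norm (lower_half (D T ** transpose (D T))) \<le> (1/2) * norm (D T)"
      using q[of "D T"] by linarith
    moreover have "norm (D T) \<le> norm (h (T - S)) + norm (lower_half (D T ** transpose (D T)))"
      by (metis D_eq[OF elim(2)] norm_triangle_ineq4)
    ultimately have DT: "norm (D T) \<le> 2 * c0 * norm (T - S)"
      using c0(2)[of "T - S"] by (simp only: mult_ac)
    \<comment> \<open>Since L A = 1, \<open>L ** D T\<close> is Chol T - L. The error is thus L
      applied to the quadratic term alone.\<close>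
    have "Chol T - Chol S - L ** h (T - S) = L ** (D T - h (T - S))"
      by (simp add: D_def A_def matrix_mult_diff_right matrix_inv_cancel[OF iL] L_def[symmetric])
    also have "D T - h (T - S) = - lower_half (D T ** transpose (D T))"
      by (subst D_eq[OF elim(2)]) simp
    also have "norm (L ** \<dots>) \<le> norm (lower_half (D T ** transpose (D T))) * c2"
      using c2(2)[of "- lower_half (D T ** transpose (D T))"] by simp
    also have "\<dots> \<le> (c1 * (norm (D T))\<^sup>2) * c2"
      using c2 by (intro mult_right_mono q) auto
    also have "\<dots> \<le> (c1 * (2 * c0 * norm (T - S))\<^sup>2) * c2"
      using DT c1 c2 by (intro mult_right_mono mult_left_mono power_mono) auto
    finally show ?case by (simp add: power_mult_distrib mult_ac)
  qed
  have "Chol_deriv S = (\<lambda>X. L ** h X)"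
    by (simp add: fun_eq_iff Chol_deriv_def h_def A_def L_def)
  with has_derivative_within_quadratic[OF bounded_linear_compose[OF bounded_linear_matrix_mult_right h] ev]
  show ?thesis by simp
qed

lemma Ck_on_Chol: "Ck_on k sym_mats spd_mats (Chol :: 'n::{finite,linorder} sqmat \<Rightarrow> 'n sqmat)"
proof (induction k)
  case 0
  then show ?case
    using has_derivative_Chol has_derivative_continuous
    by (fastforce simp: continuous_on_eq_continuous_within)
next
  case (Suc k)
  have inv: "Ck_on k sym_mats spd_mats (\<lambda>S :: 'n sqmat. matrix_inv (Chol S))"
    by (intro Ck_on_matrix_inv spd_open Suc lt_pos_invertible Chol_works)
  show ?case
  proof (rule Ck_on_SucI[OF spd_open has_derivative_Chol])
    show "Ck_on k sym_mats spd_mats (\<lambda>S. Chol_deriv S X)" for X :: "'n sqmat"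
      unfolding Chol_deriv_def
      by (intro Ck_on_matrix_mult Ck_on_compose_linear[OF _ bounded_linear_lower_half] Ck_on_transpose
          Ck_on_const spd_open Suc inv)
  qed
qed

lemma bij_betw_Chol: "bij_betw Chol spd_mats (lt_pos_mats :: 'n::{finite,linorder} sqmat set)"
  by (rule bij_betw_byWitness[where f' = "\<lambda>L. L ** transpose L"])
    (auto simp: Chol_works Chol_mult_transpose lt_pos_spd)

lemma diffeomorphism_Chol:
  "diffeomorphism_on sym_mats spd_mats lt_mats lt_pos_mats (Chol :: 'n::{finite,linorder} sqmat \<Rightarrow> 'n sqmat)"
proof -
  have "inv_into spd_mats Chol L = L ** transpose L" if "L \<in> lt_pos_mats" for L :: "'n sqmat"
    using that by (metis Chol_mult_transpose bij_betw_Chol bij_betw_inv_into_left lt_pos_spd)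
  then have "Ck_on k lt_mats lt_pos_mats (inv_into spd_mats (Chol :: 'n sqmat \<Rightarrow> _)) \<longleftrightarrow>
      Ck_on k lt_mats lt_pos_mats (\<lambda>L :: 'n sqmat. L ** transpose L)" for k
    by (rule Ck_on_cong)
  moreover have "Ck_on k lt_mats lt_pos_mats (\<lambda>L :: 'n sqmat. L ** transpose L)" for k
    by (intro Ck_on_matrix_mult Ck_on_transpose Ck_on_linear lt_pos_open bounded_linear_ident)
  ultimately show ?thesis
    by (simp add: diffeomorphism_on_def smooth_map_on_def spd_open lt_pos_open bij_betw_Chol Ck_on_Chol)
qed

section \<open>The two Lie groups\<close>

lemma lt_group_simps [simp]:
  "carrier lt_group = lt_pos_mats" "x \<otimes>\<^bsub>lt_group\<^esub> y = x ** y" "\<one>\<^bsub>lt_group\<^esub> = mat 1"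
  by (simp_all add: lt_group_def)

lemma group_lt_group: "group (lt_group :: 'n::{finite,linorder} sqmat monoid)"
proof (rule groupI)
  fix x :: "'n sqmat" assume "x \<in> carrier lt_group"
  then show "\<exists>y\<in>carrier lt_group. y \<otimes>\<^bsub>lt_group\<^esub> x = \<one>\<^bsub>lt_group\<^esub>"
    by (auto intro!: bexI[of _ "matrix_inv x"] matrix_inv_works lt_pos_invertible lt_pos_mats_inv)
qed (auto simp: lt_pos_mats_mult mat_1_lt_pos matrix_mul_assoc)

lemma m_inv_lt_group:
  fixes x :: "'n::{finite,linorder} sqmat"
  assumes "x \<in> lt_pos_mats"
  shows "m_inv lt_group x = matrix_inv x"
  using assms
  by (intro group.inv_equality[OF group_lt_group])
    (auto intro!: matrix_inv_works lt_pos_invertible lt_pos_mats_inv)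

lemma open_in_subspace_Times:
  assumes "open_in_subspace V U" "open_in_subspace V' U'"
  shows "open_in_subspace (V \<times> V') (U \<times> U')"
  using assms by (auto simp: open_in_subspace_def subspace_Times intro: openin_Times)

lemma lie_group_lt: "lie_group_on lt_mats (lt_group :: 'n::{finite,linorder} sqmat monoid)"
proof -
  have "Ck_on k (lt_mats \<times> lt_mats) (lt_pos_mats \<times> lt_pos_mats) (\<lambda>p :: 'n sqmat \<times> 'n sqmat. fst p ** snd p)" for k
    by (intro Ck_on_matrix_mult Ck_on_linear open_in_subspace_Times lt_pos_open
        bounded_linear_fst bounded_linear_snd)
  moreover have "Ck_on k lt_mats lt_pos_mats (m_inv lt_group :: 'n sqmat \<Rightarrow> 'n sqmat)" for k
  proof -
    have "Ck_on k lt_mats lt_pos_mats (\<lambda>x :: 'n sqmat. matrix_inv x)"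
      by (intro Ck_on_matrix_inv Ck_on_linear lt_pos_open bounded_linear_ident lt_pos_invertible)
    then show ?thesis
      using Ck_on_cong[of lt_pos_mats "m_inv lt_group :: 'n sqmat \<Rightarrow> 'n sqmat" matrix_inv k lt_mats]
      by (simp add: m_inv_lt_group)
  qed
  ultimately show ?thesis
    by (simp add: lie_group_on_def lt_pos_open group_lt_group smooth_map_on_def case_prod_unfold)
qed

section \<open>The group transported to positive definite matrices\<close>

lemma cholesky_group_simps [simp]:
  "carrier cholesky_group = spd_mats"
  "S \<otimes>\<^bsub>cholesky_group\<^esub> T = (Chol S ** Chol T) ** transpose (Chol S ** Chol T)"
  "\<one>\<^bsub>cholesky_group\<^esub> = mat 1"
  by (simp_all add: cholesky_group_def)

lemma Chol_cholesky_mult: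
  assumes "S \<in> spd_mats" "T \<in> spd_mats"
  shows "Chol ((Chol S ** Chol T) ** transpose (Chol S ** Chol T)) = Chol S ** Chol T"
  using assms by (intro Chol_mult_transpose lt_pos_mats_mult Chol_works)

lemma Chol_mat_1: "Chol (mat 1) = mat 1"
  using Chol_mult_transpose[OF mat_1_lt_pos] by simp

text \<open>Makes each left translation the restriction of a linear map, so that it is its own
  differential.\<close>

lemma cholesky_mult_eq_congruence:
  assumes "T \<in> spd_mats"
  shows "(L ** Chol T) ** transpose (L ** Chol T) = L ** T ** transpose L"
proof -
  have "(L ** Chol T) ** transpose (L ** Chol T) = L ** (Chol T ** transpose (Chol T)) ** transpose L"
    by (simp add: matrix_transpose_mul matrix_mul_assoc)
  then show ?thesis by (simp add: Chol_works(2)[OF assms])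
qed

text \<open>The group inverse is the element with Cholesky factor L^-1, namely L^-1 L^-T; in general
  it differs from the matrix inverse L^-T L^-1.\<close>

lemma cholesky_left_inverse:
  fixes S :: "'n::{finite,linorder} sqmat"
  assumes S: "S \<in> spd_mats"
  defines "T \<equiv> matrix_inv (Chol S) ** transpose (matrix_inv (Chol S))"
  shows "T \<in> spd_mats" "T \<otimes>\<^bsub>cholesky_group\<^esub> S = mat 1"
proof -
  have A: "matrix_inv (Chol S) \<in> lt_pos_mats"
    by (intro lt_pos_mats_inv Chol_works S)
  then show "T \<in> spd_mats" unfolding T_def by (rule lt_pos_spd)
  have "matrix_inv (Chol S) ** Chol S = mat 1"
    by (intro matrix_inv_works lt_pos_invertible Chol_works S)
  then show "T \<otimes>\<^bsub>cholesky_group\<^esub> S = mat 1"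
    by (simp add: T_def Chol_mult_transpose[OF A])
qed

lemma group_cholesky_group: "group (cholesky_group :: 'n::{finite,linorder} sqmat monoid)"
proof (rule groupI)
  fix x y :: "'n sqmat" assume "x \<in> carrier cholesky_group" "y \<in> carrier cholesky_group"
  then show "x \<otimes>\<^bsub>cholesky_group\<^esub> y \<in> carrier cholesky_group"
    by (simp add: lt_pos_spd lt_pos_mats_mult Chol_works)
next
  fix x :: "'n sqmat" assume "x \<in> carrier cholesky_group"
  then show "\<exists>y\<in>carrier cholesky_group. y \<otimes>\<^bsub>cholesky_group\<^esub> x = \<one>\<^bsub>cholesky_group\<^esub>"
    using cholesky_left_inverse[of x] by auto
qed (simp_all add: mat_1_spd Chol_cholesky_mult Chol_mat_1 Chol_works matrix_mul_assoc)

lemma m_inv_cholesky_group: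
  fixes S :: "'n::{finite,linorder} sqmat"
  assumes "S \<in> spd_mats"
  shows "m_inv cholesky_group S = matrix_inv (Chol S) ** transpose (matrix_inv (Chol S))"
  using assms cholesky_left_inverse[OF assms]
  by (intro group.inv_equality[OF group_cholesky_group]) (simp_all del: cholesky_group_simps(2))

lemma lie_group_cholesky:
  "lie_group_on sym_mats (cholesky_group :: 'n::{finite,linorder} sqmat monoid)"
proof -
  let ?V = "sym_mats \<times> sym_mats :: ('n sqmat \<times> 'n sqmat) set"
  let ?U = "spd_mats \<times> spd_mats :: ('n sqmat \<times> 'n sqmat) set"
  have U: "open_in_subspace ?V ?U"
    by (intro open_in_subspace_Times spd_open)
  have "Ck_on k ?V ?U (\<lambda>p. Chol (fst p))" "Ck_on k ?V ?U (\<lambda>p. Chol (snd p))" for k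
    by (rule Ck_on_precompose_linear[OF U bounded_linear_fst _ _ Ck_on_Chol]; auto)
      (rule Ck_on_precompose_linear[OF U bounded_linear_snd _ _ Ck_on_Chol]; auto)
  then have "Ck_on k ?V ?U (\<lambda>p. (Chol (fst p) ** Chol (snd p)) ** transpose (Chol (fst p) ** Chol (snd p)))" for k
    by (intro Ck_on_matrix_mult Ck_on_transpose U)
  moreover have "Ck_on k sym_mats spd_mats (m_inv cholesky_group :: 'n sqmat \<Rightarrow> 'n sqmat)" for k
  proof -
    have "Ck_on k sym_mats spd_mats
        (\<lambda>S :: 'n sqmat. matrix_inv (Chol S) ** transpose (matrix_inv (Chol S)))"
      by (intro Ck_on_matrix_mult Ck_on_transpose Ck_on_matrix_inv Ck_on_Chol spd_open
          lt_pos_invertible Chol_works)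
    then show ?thesis
      using Ck_on_cong[of spd_mats "m_inv cholesky_group :: 'n sqmat \<Rightarrow> 'n sqmat"
          "\<lambda>S. matrix_inv (Chol S) ** transpose (matrix_inv (Chol S))" k sym_mats]
      by (simp add: m_inv_cholesky_group)
  qed
  ultimately show ?thesis
    by (simp add: lie_group_on_def spd_open group_cholesky_group smooth_map_on_def case_prod_unfold)
qed

section \<open>Differentials of left translations\<close>

lemma left_translation_deriv_lt:
  fixes a :: "'n::{finite,linorder} sqmat"
  assumes "x \<in> lt_pos_mats" "v \<in> lt_mats"
  shows "left_translation_deriv lt_group a x v = a ** v"
  unfolding left_translation_deriv_def lt_group_simps
  by (intro frechet_derivative_relopen[OF lt_pos_open assms]
      bounded_linear_imp_has_derivative bounded_linear_matrix_mult_right)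

lemma left_translation_deriv_cholesky:
  fixes a :: "'n::{finite,linorder} sqmat"
  assumes "x \<in> spd_mats" "v \<in> sym_mats"
  shows "left_translation_deriv cholesky_group a x v = Chol a ** v ** transpose (Chol a)"
  unfolding left_translation_deriv_def cholesky_group_simps
proof (rule frechet_derivative_relopen[OF spd_open assms])
  show "((\<lambda>y. Chol a ** Chol y ** transpose (Chol a ** Chol y)) has_derivative
      (\<lambda>v. Chol a ** v ** transpose (Chol a))) (at x within spd_mats)"
    by (rule has_derivative_transform[OF assms(1) cholesky_mult_eq_congruence
          bounded_linear_imp_has_derivative[OF bounded_linear_congruence]])
qed

section \<open>The affine-invariant metric\<close>

lemma affine_invariant_metric_mat_1:
  "affine_invariant_metric \<alpha> \<beta> (mat 1) X Y = \<alpha> * trace (X ** Y) + \<beta> * trace X * trace Y"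
  by (simp add: affine_invariant_metric_def matrix_inv_mat_1)

text \<open>Writing B = A^T, congruence conjugates the endomorphism S^-1 X into B^-1 (S^-1 X) B, and
  the metric depends on such endomorphisms only through traces of products.\<close>

lemma affine_invariant_metric_congruence:
  fixes A S :: "'n::finite sqmat"
  assumes A: "invertible A" and S: "invertible S"
  shows "affine_invariant_metric \<alpha> \<beta> (A ** S ** transpose A) (A ** X ** transpose A) (A ** Y ** transpose A)
      = affine_invariant_metric \<alpha> \<beta> S X Y"
proof -
  note At = transpose_invertible[OF A]
  let ?B = "transpose A"
  have e: "matrix_inv (A ** S ** ?B) ** (A ** Z ** ?B) = matrix_inv ?B ** (matrix_inv S ** Z) ** ?B" for Z
  proof -
    have "matrix_inv (A ** S ** ?B) ** (A ** Z ** ?B)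
        = matrix_inv ?B ** matrix_inv S ** (matrix_inv A ** (A ** (Z ** ?B)))"
      by (simp only: matrix_inv_mult[OF invertible_mult[OF A S] At] matrix_inv_mult[OF A S] matrix_mul_assoc)
    then show ?thesis by (simp only: matrix_inv_cancel[OF A] matrix_mul_assoc)
  qed
  have "matrix_inv (A ** S ** ?B) ** (A ** X ** ?B) ** matrix_inv (A ** S ** ?B) ** (A ** Y ** ?B)
      = matrix_inv (A ** S ** ?B) ** (A ** X ** ?B) ** (matrix_inv (A ** S ** ?B) ** (A ** Y ** ?B))"
    by (simp only: matrix_mul_assoc)
  also have "\<dots> = matrix_inv ?B ** (matrix_inv S ** X) ** (?B ** (matrix_inv ?B ** (matrix_inv S ** Y ** ?B)))"
    unfolding e by (simp only: matrix_mul_assoc)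
  also have "\<dots> = matrix_inv ?B ** (matrix_inv S ** X ** matrix_inv S ** Y) ** ?B"
    by (simp only: matrix_inv_cancel[OF At] matrix_mul_assoc)
  finally show ?thesis
    unfolding affine_invariant_metric_def e by (simp only: e trace_similar[OF At])
qed

lemma affine_invariant_metric_Chol:
  fixes S :: "'n::{finite,linorder} sqmat"
  assumes S: "S \<in> spd_mats"
  defines "A \<equiv> matrix_inv (Chol S)"
  shows "affine_invariant_metric \<alpha> \<beta> S X Y
      = affine_invariant_metric \<alpha> \<beta> (mat 1) (A ** X ** transpose A) (A ** Y ** transpose A)"
proof -
  have "invertible A"
    unfolding A_def by (intro invertible_matrix_inv lt_pos_invertible Chol_works S)
  then show ?thesis
    using affine_invariant_metric_congruence[OF _ spd_invertible[OF S], of A \<alpha> \<beta> X Y]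
    by (simp add: A_def Chol_whitening[OF S])
qed

lemma trace_sym_square:
  assumes "X \<in> sym_mats"
  shows "trace (X ** X) = X \<bullet> X"
proof -
  have "X $ i $ j = X $ j $ i" for i j
    using assms by (auto simp: sym_mats_def transpose_def vec_eq_iff)
  then show ?thesis
    by (auto simp: trace_def matrix_matrix_mult_def inner_vec_def intro!: sum.cong)
qed

text \<open>Cauchy-Schwarz against the identity matrix, whose squared norm is n. Equality at
  multiples of the identity is what makes -\<alpha>/n the critical value of \<beta>.\<close>

lemma trace_square_le:
  fixes X :: "'n::finite sqmat"
  shows "(trace X)\<^sup>2 \<le> real CARD('n) * (X \<bullet> X)"
proof -
  have "(trace X)\<^sup>2 = (X \<bullet> mat 1)\<^sup>2"
    by (simp add: trace_def inner_vec_def mat_def if_distrib cong: if_cong)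
  also have "\<dots> \<le> (X \<bullet> X) * ((mat 1 :: 'n sqmat) \<bullet> mat 1)"
    by (rule Cauchy_Schwarz_ineq)
  also have "(mat 1 :: 'n sqmat) \<bullet> mat 1 = real CARD('n)"
    by (simp add: inner_vec_def mat_def if_distrib cong: if_cong)
  finally show ?thesis by (simp add: mult.commute)
qed

lemma affine_invariant_metric_mat_1_pos:
  fixes X :: "'n::finite sqmat"
  assumes \<alpha>: "\<alpha> > 0" and \<beta>: "\<beta> > - (\<alpha> / real CARD('n))" and X: "X \<in> sym_mats" "X \<noteq> 0"
  shows "affine_invariant_metric \<alpha> \<beta> (mat 1) X X > 0"
proof -
  have pos: "X \<bullet> X > 0" using X by simp
  have "\<alpha> * (X \<bullet> X) + \<beta> * (trace X)\<^sup>2 > 0"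
  proof (cases "\<beta> \<ge> 0")
    case True
    then show ?thesis using \<alpha> pos by (simp add: add_pos_nonneg)
  next
    case False
    \<comment> \<open>For negative \<beta>, the trace term is smallest when (tr X)^2 reaches n (X .
      X), so this coefficient bounds the form from below.\<close>
    have "\<alpha> + \<beta> * real CARD('n) > 0"
      using \<beta> by (simp add: field_simps)
    then have "0 < (\<alpha> + \<beta> * real CARD('n)) * (X \<bullet> X)"
      using pos by simp
    also have "\<dots> = \<alpha> * (X \<bullet> X) + \<beta> * (real CARD('n) * (X \<bullet> X))"
      by (simp add: algebra_simps)
    also have "\<dots> \<le> \<alpha> * (X \<bullet> X) + \<beta> * (trace X)\<^sup>2"
      using False trace_square_le[of X] by (intro add_left_mono mult_left_mono_neg) auto
    finally show ?thesis .
  qed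
  then show ?thesis
    by (simp add: affine_invariant_metric_mat_1 trace_sym_square[OF X(1)] power2_eq_square)
qed

lemma inner_product_affine_mat_1:
  assumes "\<alpha> > 0" "\<beta> > - (\<alpha> / real CARD('n::finite))"
  shows "inner_product_on (sym_mats :: 'n sqmat set) (affine_invariant_metric \<alpha> \<beta> (mat 1))"
  unfolding inner_product_on_def
proof (intro conjI ballI allI impI affine_invariant_metric_mat_1_pos assms)
  fix u v w :: "'n sqmat" and c :: real
  show "affine_invariant_metric \<alpha> \<beta> (mat 1) v w = affine_invariant_metric \<alpha> \<beta> (mat 1) w v"
    by (simp add: affine_invariant_metric_mat_1 trace_mul_sym[of v w])
  show "affine_invariant_metric \<alpha> \<beta> (mat 1) (u + v) w
      = affine_invariant_metric \<alpha> \<beta> (mat 1) u w + affine_invariant_metric \<alpha> \<beta> (mat 1) v w"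
    by (simp add: affine_invariant_metric_mat_1 trace_add
        bounded_bilinear.add_left[OF bounded_bilinear_matrix_matrix_mult] algebra_simps)
  show "affine_invariant_metric \<alpha> \<beta> (mat 1) (c *\<^sub>R v) w = c * affine_invariant_metric \<alpha> \<beta> (mat 1) v w"
    by (simp add: affine_invariant_metric_mat_1 scalar_matrix_assoc[symmetric]
        linear_cmul[OF bounded_linear.linear[OF bounded_linear_trace]] algebra_simps)
qed

text \<open>Carries positivity from the identity matrix to all other cases: along congruence to
  another S, along Z \<mapsto> Z + Z^T to \<open>lt_mats\<close>, and along multiplication by x^-1
  to another point of the triangular group.\<close>

lemma inner_product_on_linear_injective:
  assumes "inner_product_on V b" "linear T" "T ` W \<subseteq> V" "\<And>w. w \<in> W \<Longrightarrow> T w = 0 \<Longrightarrow> w = 0"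
  shows "inner_product_on W (\<lambda>v w. b (T v) (T w))"
  unfolding inner_product_on_def linear_add[OF assms(2)] linear_cmul[OF assms(2)]
proof (intro conjI ballI allI impI)
  note ip = assms(1)[unfolded inner_product_on_def]
  note b = ip[THEN conjunct1, rule_format]
    ip[THEN conjunct2, THEN conjunct1, rule_format]
    ip[THEN conjunct2, THEN conjunct2, THEN conjunct1, rule_format]
    ip[THEN conjunct2, THEN conjunct2, THEN conjunct2, rule_format]
  have T: "T w \<in> V" if "w \<in> W" for w
    using assms(3) that by blast
  fix u v w c
  assume w: "w \<in> W"
  show "b (T v) (T w) = b (T w) (T v)" if "v \<in> W"
    by (rule b(1)[OF T[OF that] T[OF w]])
  show "b (T u + T v) (T w) = b (T u) (T w) + b (T v) (T w)" if "u \<in> W" "v \<in> W"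
    by (rule b(2)[OF T[OF that(1)] T[OF that(2)] T[OF w]])
  show "b (c *\<^sub>R T v) (T w) = c * b (T v) (T w)" if "v \<in> W"
    by (rule b(3)[OF T[OF that] T[OF w]])
  show "b (T w) (T w) > 0" if "w \<noteq> 0"
    using assms(4)[OF w] that by (intro b(4)[OF T[OF w]]) auto
qed

lemma inner_product_on_cong:
  assumes "subspace V" "\<And>v w. v \<in> V \<Longrightarrow> w \<in> V \<Longrightarrow> b v w = b' v w"
  shows "inner_product_on V b \<longleftrightarrow> inner_product_on V b'"
  unfolding inner_product_on_def
  by (simp add: assms(2) subspace_add[OF assms(1)] subspace_scale[OF assms(1)])

lemma inner_product_affine:
  fixes S :: "'n::{finite,linorder} sqmat"
  assumes pos: "\<alpha> > 0" "\<beta> > - (\<alpha> / real CARD('n))" and S: "S \<in> spd_mats"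
  shows "inner_product_on sym_mats (affine_invariant_metric \<alpha> \<beta> S)"
proof -
  let ?A = "matrix_inv (Chol S)"
  have A: "invertible ?A"
    by (intro invertible_matrix_inv lt_pos_invertible Chol_works S)
  have "inner_product_on sym_mats (\<lambda>X Y. affine_invariant_metric \<alpha> \<beta> (mat 1)
      (?A ** X ** transpose ?A) (?A ** Y ** transpose ?A))"
  proof (rule inner_product_on_linear_injective[OF inner_product_affine_mat_1[OF pos]])
    show "linear (\<lambda>X. ?A ** X ** transpose ?A)"
      by (rule bounded_linear.linear[OF bounded_linear_congruence])
    show "(\<lambda>X. ?A ** X ** transpose ?A) ` sym_mats \<subseteq> sym_mats"
      using sym_mats_congruence by blast
    fix X assume "?A ** X ** transpose ?A = 0"
    then have "matrix_inv ?A ** (?A ** X ** transpose ?A) ** matrix_inv (transpose ?A) = 0"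
      by (simp add: bounded_bilinear.zero_left[OF bounded_bilinear_matrix_matrix_mult]
          bounded_bilinear.zero_right[OF bounded_bilinear_matrix_matrix_mult])
    then show "X = 0"
      by (simp only: matrix_mul_assoc matrix_inv_works[OF A] matrix_mul_lid
          matrix_inv_cancel[OF transpose_invertible[OF A]])
  qed
  moreover have "affine_invariant_metric \<alpha> \<beta> S = (\<lambda>X Y. affine_invariant_metric \<alpha> \<beta> (mat 1)
      (?A ** X ** transpose ?A) (?A ** Y ** transpose ?A))"
    by (intro ext affine_invariant_metric_Chol S)
  ultimately show ?thesis by simp
qed

lemma inner_product_lt:
  assumes pos: "\<alpha> > 0" "\<beta> > - (\<alpha> / real CARD('n::{finite,linorder}))"
  shows "inner_product_on (lt_mats :: 'n sqmat set) (lt_inner \<alpha> \<beta>)"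
  unfolding lt_inner_def
proof (rule inner_product_on_linear_injective[OF inner_product_affine_mat_1[OF pos]])
  show "linear (\<lambda>Z :: 'n sqmat. Z + transpose Z)"
    by (simp add: linear_iff transpose_def vec_eq_iff algebra_simps)
  show "(\<lambda>Z. Z + transpose Z) ` lt_mats \<subseteq> sym_mats"
    by (auto simp: sym_mats_def transpose_add add.commute)
  show "Z = 0" if "Z \<in> lt_mats" "Z + transpose Z = 0" for Z :: "'n sqmat"
    using lower_half_add_transpose[OF that(1)] that(2)
      linear_0[OF bounded_linear.linear[OF bounded_linear_lower_half]] by metis
qed

text \<open>All three arguments may vary: on \<open>spd_mats\<close> the base point moves and the
  vectors are fixed, on the triangular group the base point is the identity and the vectors
  move.\<close>

lemma Ck_on_affine_invariant_metric:
  fixes S :: "'a::real_normed_vector \<Rightarrow> 'n::finite sqmat"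
  assumes U: "open_in_subspace V U" and inv: "\<And>x. x \<in> U \<Longrightarrow> invertible (S x)"
    and C: "Ck_on k V U S" "Ck_on k V U X" "Ck_on k V U Y"
  shows "Ck_on k V U (\<lambda>x. affine_invariant_metric \<alpha> \<beta> (S x) (X x) (Y x))"
proof -
  have scale: "Ck_on k V U (\<lambda>x. c * trace (M x))" if "Ck_on k V U M" for c and M :: "'a \<Rightarrow> 'n sqmat"
    by (rule Ck_on_compose_linear[OF U bounded_linear_const_mult[OF bounded_linear_trace] that])
  have tr: "Ck_on k V U (\<lambda>x. trace (M x))" if "Ck_on k V U M" for M :: "'a \<Rightarrow> 'n sqmat"
    by (rule Ck_on_compose_linear[OF U bounded_linear_trace that])
  show ?thesis
    unfolding affine_invariant_metric_def
    by (intro Ck_on_add scale tr Ck_on_bilinear[OF U bounded_bilinear_mult] Ck_on_matrix_mult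
        Ck_on_matrix_inv U inv C)
qed

lemma left_invariant_affine:
  assumes pos: "\<alpha> > 0" "\<beta> > - (\<alpha> / real CARD('n::{finite,linorder}))"
  shows "left_invariant_metric sym_mats (cholesky_group :: 'n sqmat monoid) (affine_invariant_metric \<alpha> \<beta>)"
  unfolding left_invariant_metric_def riemannian_metric_on_def smooth_map_on_def
    cholesky_group_simps(1)
proof (intro conjI ballI allI inner_product_affine pos)
  show "Ck_on k sym_mats spd_mats (\<lambda>x. affine_invariant_metric \<alpha> \<beta> x v w)" for k and v w :: "'n sqmat"
    by (intro Ck_on_affine_invariant_metric spd_open spd_invertible Ck_on_linear Ck_on_const bounded_linear_ident)
  fix a x v w :: "'n sqmat"
  assume a: "a \<in> spd_mats" and x: "x \<in> spd_mats" and vw: "v \<in> sym_mats" "w \<in> sym_mats"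
  show "affine_invariant_metric \<alpha> \<beta> (a \<otimes>\<^bsub>cholesky_group\<^esub> x)
      (left_translation_deriv cholesky_group a x v) (left_translation_deriv cholesky_group a x w)
      = affine_invariant_metric \<alpha> \<beta> x v w"
    unfolding left_translation_deriv_cholesky[OF x vw(1)] left_translation_deriv_cholesky[OF x vw(2)]
      cholesky_group_simps cholesky_mult_eq_congruence[OF x]
    by (intro affine_invariant_metric_congruence lt_pos_invertible Chol_works a spd_invertible x)
qed

section \<open>The metric on the triangular group and its pullback\<close>

lemma left_invariant_extension_lt:
  fixes x :: "'n::{finite,linorder} sqmat"
  assumes "x \<in> lt_pos_mats" "v \<in> lt_mats" "w \<in> lt_mats"
  shows "left_invariant_extension lt_group b x v w = b (matrix_inv x ** v) (matrix_inv x ** w)"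
  unfolding left_invariant_extension_def
  by (simp add: left_translation_deriv_lt m_inv_lt_group assms)

lemma left_invariant_lt:
  assumes pos: "\<alpha> > 0" "\<beta> > - (\<alpha> / real CARD('n::{finite,linorder}))"
  shows "left_invariant_metric lt_mats (lt_group :: 'n sqmat monoid)
    (left_invariant_extension lt_group (lt_inner \<alpha> \<beta>))"
  unfolding left_invariant_metric_def riemannian_metric_on_def smooth_map_on_def lt_group_simps
proof (intro conjI ballI allI)
  fix x :: "'n sqmat" assume x: "x \<in> lt_pos_mats"
  note ix = lt_pos_invertible[OF x]
  have "inner_product_on lt_mats (\<lambda>v w. lt_inner \<alpha> \<beta> (matrix_inv x ** v) (matrix_inv x ** w))"
  proof (rule inner_product_on_linear_injective[OF inner_product_lt[OF pos]])
    show "linear (\<lambda>v :: 'n sqmat. matrix_inv x ** v)"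
      by (rule bounded_linear.linear[OF bounded_linear_matrix_mult_right])
    show "(\<lambda>v :: 'n sqmat. matrix_inv x ** v) ` lt_mats \<subseteq> lt_mats"
      using lt_pos_mats_inv[OF x] by (auto intro: lt_mats_mult lt_pos_matsD)
    show "v = 0" if "matrix_inv x ** v = 0" for v :: "'n sqmat"
      using matrix_inv_cancel(1)[OF ix, of v] that
      by (simp add: bounded_bilinear.zero_right[OF bounded_bilinear_matrix_matrix_mult])
  qed
  moreover have "inner_product_on lt_mats (left_invariant_extension lt_group (lt_inner \<alpha> \<beta>) x) \<longleftrightarrow>
      inner_product_on lt_mats (\<lambda>v w. lt_inner \<alpha> \<beta> (matrix_inv x ** v) (matrix_inv x ** w))"
    by (rule inner_product_on_cong[OF subspace_lt_mats left_invariant_extension_lt[OF x]])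
  ultimately show "inner_product_on lt_mats (left_invariant_extension lt_group (lt_inner \<alpha> \<beta>) x)"
    by blast
next
  fix v w :: "'n sqmat" and k
  assume vw: "v \<in> lt_mats" "w \<in> lt_mats"
  have "Ck_on k lt_mats lt_pos_mats (\<lambda>x. lt_inner \<alpha> \<beta> (matrix_inv x ** v) (matrix_inv x ** w))"
    unfolding lt_inner_def
    by (intro Ck_on_affine_invariant_metric Ck_on_add Ck_on_transpose Ck_on_matrix_mult Ck_on_matrix_inv
        Ck_on_linear Ck_on_const lt_pos_open bounded_linear_ident lt_pos_invertible mat_1_lt_pos)
  then show "Ck_on k lt_mats lt_pos_mats (\<lambda>x. left_invariant_extension lt_group (lt_inner \<alpha> \<beta>) x v w)"
    using Ck_on_cong[of lt_pos_mats "\<lambda>x. left_invariant_extension lt_group (lt_inner \<alpha> \<beta>) x v w"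
        "\<lambda>x. lt_inner \<alpha> \<beta> (matrix_inv x ** v) (matrix_inv x ** w)" k lt_mats]
      left_invariant_extension_lt[OF _ vw] by simp
next
  fix a x v w :: "'n sqmat"
  assume a: "a \<in> lt_pos_mats" and x: "x \<in> lt_pos_mats" and vw: "v \<in> lt_mats" "w \<in> lt_mats"
  have av: "a ** u \<in> lt_mats" if "u \<in> lt_mats" for u
    by (intro lt_mats_mult lt_pos_matsD a that)
  \<comment> \<open>Left invariance in one line: the translation factor a cancels when vectors are
    brought back to the identity.\<close>
  have "matrix_inv (a ** x) ** (a ** u) = matrix_inv x ** u" for u :: "'n sqmat"
  proof -
    have "matrix_inv (a ** x) ** (a ** u) = matrix_inv x ** (matrix_inv a ** (a ** u))"
      by (simp add: matrix_inv_mult lt_pos_invertible a x matrix_mul_assoc)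
    then show ?thesis by (simp only: matrix_inv_cancel[OF lt_pos_invertible[OF a]])
  qed
  then show "left_invariant_extension lt_group (lt_inner \<alpha> \<beta>) (a ** x)
      (left_translation_deriv lt_group a x v) (left_translation_deriv lt_group a x w)
      = left_invariant_extension lt_group (lt_inner \<alpha> \<beta>) x v w"
    by (simp add: left_translation_deriv_lt x vw left_invariant_extension_lt lt_pos_mats_mult a av)
qed

text \<open>Expanding (Z + Z^T)^2 gives tr(Z Z^T) twice and tr(Z^2) twice. The diagonal of Z^2
  consists of the squared diagonal entries of Z by triangularity, which produces the
  \<open>Diag\<close> term.\<close>

lemma lt_inner_formula:
  fixes Z :: "'n::{finite,linorder} sqmat"
  assumes Z: "Z \<in> lt_mats"
  shows "lt_inner \<alpha> \<beta> Z Z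
    = 2 * \<alpha> * trace (Z ** transpose Z) + 2 * \<alpha> * trace (Diag Z ** Diag Z) + 4 * \<beta> * (trace Z)\<^sup>2"
proof -
  have D: "Diag Z \<in> lt_mats" by (simp add: Diag_def lt_mats_def)
  have ZZ: "trace (Z ** Z) = trace (Diag Z ** Diag Z)"
    unfolding trace_def lt_mats_mult_diag[OF Z Z] lt_mats_mult_diag[OF D D] by (simp add: Diag_def)
  have "trace ((Z + transpose Z) ** (Z + transpose Z))
      = trace (Z ** Z) + trace (Z ** transpose Z) + (trace (transpose Z ** Z) + trace (transpose Z ** transpose Z))"
    by (simp add: bounded_bilinear.add_left[OF bounded_bilinear_matrix_matrix_mult] matrix_add_ldistrib trace_add)
  also have "\<dots> = 2 * trace (Z ** transpose Z) + 2 * trace (Diag Z ** Diag Z)"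
    using trace_transpose[of "Z ** Z"] trace_mul_sym[of "transpose Z" Z]
    by (simp add: matrix_transpose_mul ZZ)
  finally show ?thesis
    by (simp add: lt_inner_def affine_invariant_metric_mat_1 trace_add trace_transpose
        power2_eq_square algebra_simps)
qed

lemma affine_eq_pullback:
  fixes S :: "'n::{finite,linorder} sqmat"
  assumes S: "S \<in> spd_mats" and XY: "X \<in> sym_mats" "Y \<in> sym_mats"
  shows "affine_invariant_metric \<alpha> \<beta> S X Y =
    pullback_metric spd_mats Chol (left_invariant_extension lt_group (lt_inner \<alpha> \<beta>)) S X Y"
proof -
  let ?L = "Chol S" and ?A = "matrix_inv (Chol S)"
  note L = Chol_works(1)[OF S]
  have deriv: "frechet_derivative Chol (at S within spd_mats) X = Chol_deriv S X" if "X \<in> sym_mats" for X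
    by (rule frechet_derivative_relopen[OF spd_open S that has_derivative_Chol[OF S]])
  have lt: "Chol_deriv S X \<in> lt_mats" for X
    unfolding Chol_deriv_def by (intro lt_mats_mult lower_half_lt lt_pos_matsD L)
  \<comment> \<open>\<open>lt_inner\<close> symmetrizes its arguments and thereby undoes
    \<open>lower_half\<close>; both sides then evaluate the metric at the identity on the same
    vectors L^-1 X L^-T and L^-1 Y L^-T.\<close>
  have half: "?A ** Chol_deriv S X + transpose (?A ** Chol_deriv S X) = ?A ** X ** transpose ?A"
    if "X \<in> sym_mats" for X
    unfolding Chol_deriv_def matrix_inv_cancel[OF lt_pos_invertible[OF L]]
    by (intro lower_half_sym sym_mats_congruence that)
  show ?thesis
    unfolding pullback_metric_def deriv[OF XY(1)] deriv[OF XY(2)]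
      left_invariant_extension_lt[OF L lt lt] lt_inner_def half[OF XY(1)] half[OF XY(2)]
    by (rule affine_invariant_metric_Chol[OF S])
qed

theorem corollary3p6:
  fixes \<alpha> \<beta> :: real
  assumes "\<alpha> > 0" and "\<beta> > - (\<alpha> / real CARD('n::{finite,linorder}))"
  shows
    "diffeomorphism_on sym_mats spd_mats lt_mats lt_pos_mats (Chol :: 'n sqmat \<Rightarrow> 'n sqmat) \<and>
     lie_group_on sym_mats (cholesky_group :: 'n sqmat monoid) \<and>
     (\<forall>S \<in> (spd_mats :: 'n sqmat set). \<forall>S' \<in> spd_mats.
        S \<otimes>\<^bsub>cholesky_group\<^esub> S' = (Chol S ** Chol S') ** transpose (Chol S ** Chol S') \<and>
        (Chol S ** Chol S') ** transpose (Chol S ** Chol S') = Chol S ** S' ** transpose (Chol S)) \<and>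
     (\<forall>S \<in> (spd_mats :: 'n sqmat set). \<forall>X \<in> sym_mats.
        affine_invariant_metric \<alpha> \<beta> S X X =
          \<alpha> * trace (matrix_inv S ** X ** matrix_inv S ** X) + \<beta> * (trace (matrix_inv S ** X))\<^sup>2) \<and>
     left_invariant_metric sym_mats (cholesky_group :: 'n sqmat monoid)
       (affine_invariant_metric \<alpha> \<beta>) \<and>
     lie_group_on lt_mats (lt_group :: 'n sqmat monoid) \<and>
     inner_product_on (lt_mats :: 'n sqmat set) (lt_inner \<alpha> \<beta>) \<and>
     (\<forall>Z \<in> (lt_mats :: 'n sqmat set).
        lt_inner \<alpha> \<beta> Z Z =
          affine_invariant_metric \<alpha> \<beta> (mat 1) (Z + transpose Z) (Z + transpose Z) \<and>
        lt_inner \<alpha> \<beta> Z Z =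
          2 * \<alpha> * trace (Z ** transpose Z) + 2 * \<alpha> * trace (Diag Z ** Diag Z) + 4 * \<beta> * (trace Z)\<^sup>2) \<and>
     left_invariant_metric lt_mats (lt_group :: 'n sqmat monoid)
       (left_invariant_extension lt_group (lt_inner \<alpha> \<beta>)) \<and>
     (\<forall>Z \<in> (lt_mats :: 'n sqmat set). \<forall>W \<in> lt_mats.
        left_invariant_extension lt_group (lt_inner \<alpha> \<beta>) (mat 1) Z W = lt_inner \<alpha> \<beta> Z W) \<and>
     (\<forall>S \<in> (spd_mats :: 'n sqmat set). \<forall>X \<in> sym_mats. \<forall>Y \<in> sym_mats.
        affine_invariant_metric \<alpha> \<beta> S X Y =
          pullback_metric spd_mats Chol (left_invariant_extension lt_group (lt_inner \<alpha> \<beta>)) S X Y)"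
proof (intro conjI ballI)
  show "diffeomorphism_on sym_mats spd_mats lt_mats lt_pos_mats (Chol :: 'n sqmat \<Rightarrow> 'n sqmat)"
    by (rule diffeomorphism_Chol)
  show "lie_group_on sym_mats (cholesky_group :: 'n sqmat monoid)"
    by (rule lie_group_cholesky)
  show "lie_group_on lt_mats (lt_group :: 'n sqmat monoid)"
    by (rule lie_group_lt)
  show "left_invariant_metric sym_mats (cholesky_group :: 'n sqmat monoid) (affine_invariant_metric \<alpha> \<beta>)"
    by (rule left_invariant_affine[OF assms])
  show "left_invariant_metric lt_mats (lt_group :: 'n sqmat monoid)
      (left_invariant_extension lt_group (lt_inner \<alpha> \<beta>))"
    by (rule left_invariant_lt[OF assms])
  show "inner_product_on (lt_mats :: 'n sqmat set) (lt_inner \<alpha> \<beta>)"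
    by (rule inner_product_lt[OF assms])
next
  fix S S' :: "'n sqmat" assume "S \<in> spd_mats" "S' \<in> spd_mats"
  then show "S \<otimes>\<^bsub>cholesky_group\<^esub> S' = (Chol S ** Chol S') ** transpose (Chol S ** Chol S')"
    and "(Chol S ** Chol S') ** transpose (Chol S ** Chol S') = Chol S ** S' ** transpose (Chol S)"
    by (simp_all only: cholesky_group_simps cholesky_mult_eq_congruence)
next
  fix S X :: "'n sqmat"
  show "affine_invariant_metric \<alpha> \<beta> S X X =
      \<alpha> * trace (matrix_inv S ** X ** matrix_inv S ** X) + \<beta> * (trace (matrix_inv S ** X))\<^sup>2"
    by (simp add: affine_invariant_metric_def power2_eq_square)
next
  fix Z :: "'n sqmat" assume Z: "Z \<in> lt_mats"
  show "lt_inner \<alpha> \<beta> Z Z =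
      affine_invariant_metric \<alpha> \<beta> (mat 1) (Z + transpose Z) (Z + transpose Z)"
    by (simp add: lt_inner_def)
  show "lt_inner \<alpha> \<beta> Z Z =
      2 * \<alpha> * trace (Z ** transpose Z) + 2 * \<alpha> * trace (Diag Z ** Diag Z) + 4 * \<beta> * (trace Z)\<^sup>2"
    by (rule lt_inner_formula[OF Z])
  fix W :: "'n sqmat" assume "W \<in> lt_mats"
  then show "left_invariant_extension lt_group (lt_inner \<alpha> \<beta>) (mat 1) Z W = lt_inner \<alpha> \<beta> Z W"
    by (simp add: left_invariant_extension_lt mat_1_lt_pos Z matrix_inv_mat_1)
next
  fix S X Y :: "'n sqmat" assume "S \<in> spd_mats" "X \<in> sym_mats" "Y \<in> sym_mats"
  then show "affine_invariant_metric \<alpha> \<beta> S X Y =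
      pullback_metric spd_mats Chol (left_invariant_extension lt_group (lt_inner \<alpha> \<beta>)) S X Y"
    by (rule affine_eq_pullback)
qed

end
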